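(* Let $0<\kappa<1$, and let the elliptic function $\mathrm{rn}_2$ and the half-periods $\Omega,\Omega'$ be as defined in the context (for the modulus $\kappa$). Then the function $\mathrm{rn}_2$ has: simple zeros at $0$ and $\Omega$; simple poles at $\Omega+\Omega'$ and $\Omega'$.
   Context: $F(a,b;c;z)={}_2F_1(a,b;c;z)$ is the Gauss hypergeometric function. Fix the modulus $\kappa\in(0,1)$. The map $\mathbb{R}\to\mathbb{R}$, $T\mapsto\int_0^T F(\tfrac14,\tfrac34;\tfrac12;\kappa^2\sin^2 t)\,dt$, is an odd strictly increasing bijection; $\phi:\mathbb{R}\to\mathbb{R}$ denotes its inverse. Put $\psi=\arcsin(\kappa\sin\phi):\mathbb{R}\to(-\tfrac{\pi}{2},\tfrac{\pi}{2})$ and $\mathrm{rn}_2=\sin\tfrac12\psi:\mathbb{R}\to\mathbb{R}$. The function $\mathrm{rn}_2$ extends (uniquely) to an elliptic function on $\mathbb{C}$, still denoted $\mathrm{rn}_2$. Let $P=\wp(\bullet;G_2,G_3)$ be the Weierstrass function with invariants $G_2=\tfrac1{12}(1+3\kappa^2)$ and $G_3=\tfrac1{216}(1-9\kappa^2)$, so $(P')^2=4P^3-G_2P-G_3$. It has a fundamental pair of periods (a $\mathbb{Z}$-basis of its period lattice) $(2\Omega,2\Omega')$ with $\Omega>0$ and $-\mathrm{i}\,\Omega'>0$. *)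

theory Defs
  imports "HOL-Complex_Analysis.Complex_Analysis"
begin

text \<open>Only used for \<open>\<bar>z\<bar> < 1\<close>, where the power series converges to the Gauss function.\<close>

definition hyp2F1 :: "real \<Rightarrow> real \<Rightarrow> real \<Rightarrow> real \<Rightarrow> real" where
  "hyp2F1 a b c z = eval_fps (fps_hypergeo [a, b] [c] 1) z"

text \<open>The interval integral is oriented, so the integral changes sign for \<open>T < 0\<close>.\<close>

definition hyp_integral :: "real \<Rightarrow> real \<Rightarrow> real" where
  "hyp_integral \<kappa> T = (LBINT t=0..T. hyp2F1 (1/4) (3/4) (1/2) (\<kappa>\<^sup>2 * (sin t)\<^sup>2))"

definition rn_phi :: "real \<Rightarrow> real \<Rightarrow> real" where
  "rn_phi \<kappa> = inv (hyp_integral \<kappa>)"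

definition rn_psi :: "real \<Rightarrow> real \<Rightarrow> real" where
  "rn_psi \<kappa> u = arcsin (\<kappa> * sin (rn_phi \<kappa> u))"

definition rn2_real :: "real \<Rightarrow> real \<Rightarrow> real" where
  "rn2_real \<kappa> u = sin (rn_psi \<kappa> u / 2)"

definition periods :: "(complex \<Rightarrow> complex) \<Rightarrow> complex set" where
  "periods f = {\<omega>. \<forall>z. f (z + \<omega>) = f z}"

text \<open>Here \<open>\<omega>\<^sub>1 = 0\<close> is excluded as well, since \<open>\<omega>\<^sub>2 / 0 = 0\<close> is real.\<close>

definition R_independent :: "complex \<Rightarrow> complex \<Rightarrow> bool" where
  "R_independent \<omega>\<^sub>1 \<omega>\<^sub>2 \<longleftrightarrow> \<omega>\<^sub>2 / \<omega>\<^sub>1 \<notin> \<real>"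

definition lattice_of :: "complex \<Rightarrow> complex \<Rightarrow> complex set" where
  "lattice_of \<omega>\<^sub>1 \<omega>\<^sub>2 = {of_int m * \<omega>\<^sub>1 + of_int n * \<omega>\<^sub>2 | m n. True}"

definition is_lattice :: "complex set \<Rightarrow> bool" where
  "is_lattice \<Lambda> \<longleftrightarrow> (\<exists>\<omega>\<^sub>1 \<omega>\<^sub>2. R_independent \<omega>\<^sub>1 \<omega>\<^sub>2 \<and> \<Lambda> = lattice_of \<omega>\<^sub>1 \<omega>\<^sub>2)"

definition fundamental_periods :: "(complex \<Rightarrow> complex) \<Rightarrow> complex \<Rightarrow> complex \<Rightarrow> bool" where
  "fundamental_periods f \<omega>\<^sub>1 \<omega>\<^sub>2 \<longleftrightarrow> R_independent \<omega>\<^sub>1 \<omega>\<^sub>2 \<and> periods f = lattice_of \<omega>\<^sub>1 \<omega>\<^sub>2"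

text \<open>Requiring \<open>f\<close> to be nicely meromorphic rules out removable singularities and fixes the value
  \<open>0\<close> at the poles, so that an elliptic function is determined by its values on \<open>\<real>\<close>.\<close>

definition elliptic :: "(complex \<Rightarrow> complex) \<Rightarrow> bool" where
  "elliptic f \<longleftrightarrow> f nicely_meromorphic_on UNIV \<and>
     (\<exists>\<omega>\<^sub>1 \<omega>\<^sub>2. R_independent \<omega>\<^sub>1 \<omega>\<^sub>2 \<and> \<omega>\<^sub>1 \<in> periods f \<and> \<omega>\<^sub>2 \<in> periods f)"

definition elliptic_extension :: "(real \<Rightarrow> real) \<Rightarrow> (complex \<Rightarrow> complex) \<Rightarrow> bool" where
  "elliptic_extension g f \<longleftrightarrow> elliptic f \<and> (\<forall>x. f (of_real x) = of_real (g x))"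

definition weierstrass_p :: "complex set \<Rightarrow> complex \<Rightarrow> complex" where
  "weierstrass_p \<Lambda> z =
     (if z \<in> \<Lambda> then 0
      else 1 / z\<^sup>2 + (\<Sum>\<^sub>\<infinity>\<omega>\<in>\<Lambda> - {0}. 1 / (z - \<omega>)\<^sup>2 - 1 / \<omega>\<^sup>2))"

definition lattice_g2 :: "complex set \<Rightarrow> complex" where
  "lattice_g2 \<Lambda> = 60 * (\<Sum>\<^sub>\<infinity>\<omega>\<in>\<Lambda> - {0}. 1 / \<omega> ^ 4)"

definition lattice_g3 :: "complex set \<Rightarrow> complex" where
  "lattice_g3 \<Lambda> = 140 * (\<Sum>\<^sub>\<infinity>\<omega>\<in>\<Lambda> - {0}. 1 / \<omega> ^ 6)"

text \<open>\<open>P = \<wp>(\<bullet>; G\<^sub>2, G\<^sub>3)\<close>; the lattice, and hence \<open>P\<close>, is determined by its invariants.\<close>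

definition is_weierstrass_function :: "(complex \<Rightarrow> complex) \<Rightarrow> complex \<Rightarrow> complex \<Rightarrow> bool" where
  "is_weierstrass_function P G\<^sub>2 G\<^sub>3 \<longleftrightarrow>
     (\<exists>\<Lambda>. is_lattice \<Lambda> \<and> lattice_g2 \<Lambda> = G\<^sub>2 \<and> lattice_g3 \<Lambda> = G\<^sub>3 \<and> P = weierstrass_p \<Lambda>)"

definition simple_zero :: "(complex \<Rightarrow> complex) \<Rightarrow> complex \<Rightarrow> bool" where
  "simple_zero f z \<longleftrightarrow> isolated_zero f z \<and> zorder f z = 1"

definition simple_pole :: "(complex \<Rightarrow> complex) \<Rightarrow> complex \<Rightarrow> bool" where
  "simple_pole f z \<longleftrightarrow> is_pole f z \<and> zorder f z = -1"

end

theory Submission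
  imports Defs
begin

text \<open>
  For \<open>\<bar>y\<bar> < 1\<close> the Gauss function is elementary here: \<open>F(1/4, 3/4; 1/2; y\<^sup>2)\<close> is the even part of the binomial
  series of \<open>(1 - y) powr (-1/2)\<close>. With \<open>y = \<kappa> sin \<phi> = sin \<psi>\<close> it equals \<open>cos (\<psi>/2) / cos \<psi>\<close>, so \<open>du = F d\<phi>\<close> says
  that \<open>s = sin (\<psi>/2)\<close>, as a function of \<open>u\<close>, satisfies
    \<open>s'\<^sup>2 = s\<^sup>4 - s\<^sup>2 + \<kappa>\<^sup>2/4\<close>, \<open>s(0) = 0\<close>, \<open>s'(0) = \<kappa>/2 > 0\<close>.
  The invariants of this quartic are \<open>G\<^sub>2\<close> and \<open>G\<^sub>3\<close>, and its solution is
    \<open>s = -\<kappa> (\<wp> - 1/6) / \<wp>'\<close>,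
  where \<open>1/6\<close>, \<open>-1/12 + \<kappa>/4\<close>, \<open>-1/12 - \<kappa>/4\<close> are the roots of \<open>4x\<^sup>3 - G\<^sub>2 x - G\<^sub>3\<close>. The function on the right is
  meromorphic in the plane and agrees with \<open>rn\<^sub>2\<close> on a real interval around \<open>0\<close>, hence everywhere
  (\<open>elliptic_extension_eq_rn_wp\<close>).

  The zeros and poles can be read off from the formula. At \<open>0\<close> the numerator has a double and the
  denominator a triple pole, which leaves a simple zero. At each of the three half-periods \<open>\<wp>'\<close> has a
  simple zero (\<open>zorder_half_period\<close>); at the one where \<open>\<wp> = 1/6\<close> the numerator has a double zero, so the quotient
  has a simple zero there and simple poles at the other two.

  It remains to see that this half-period is \<open>\<Omega>\<close>. The point is that a value which \<open>\<wp>\<close> takes at a half-period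
  \<open>w\<close> is taken at the points congruent to \<open>w\<close> only (\<open>P_eq_half_period_value_imp\<close>), so that \<open>\<wp>\<close> takes the three roots at the three
  half-periods, one at each. Now \<open>\<wp>\<close> is real on \<open>(0, \<Omega>]\<close> and tends to \<open>\<infinity>\<close> at \<open>0\<close>. If \<open>\<wp>(\<Omega>)\<close> were not the largest root
  \<open>1/6\<close>, then \<open>\<wp>\<close> would take the value \<open>1/6\<close> strictly between \<open>0\<close> and \<open>\<Omega>\<close>, at a point congruent to neither \<open>\<Omega>'\<close> nor
  \<open>\<Omega> + \<Omega>'\<close> (\<open>P_half_periods_rectangular\<close>).

  The facts about \<open>\<wp>\<close> are derived from its lattice series. Both the differential equation and the statement
  on the half-period values follow from one principle: an elliptic function without poles is constant
  (\<open>elliptic_without_poles_const\<close>).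
\<close>

section \<open>The hypergeometric integral and the quartic differential equation\<close>

text \<open>
  By the duplication formula, \<open>(1/4)\<^sub>n (3/4)\<^sub>n / ((1/2)\<^sub>n n!) = (1/2)\<^sub>2\<^sub>n / (2n)!\<close>, which is the coefficient of \<open>y\<^sup>2\<^sup>n\<close>
  in the binomial series of \<open>(1 - y) powr (-1/2)\<close>; adding the series for \<open>y\<close> and \<open>-y\<close> keeps the even terms.
\<close>

lemma hyp2F1_quarter_square:
  fixes y :: real
  assumes "\<bar>y\<bar> < 1"
  shows "hyp2F1 (1/4) (3/4) (1/2) (y\<^sup>2) = (1 / sqrt (1 - y) + 1 / sqrt (1 + y)) / 2"
proof -
  define b :: "nat \<Rightarrow> real" where "b n = (-1/2) gchoose n" for n
  have ps: "(1 + x) powr (-1/2) = 1 / sqrt (1 + x)" if "\<bar>x\<bar> < 1" for x :: real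
    using that powr_minus_divide[of "1 + x" "1/2"] by (simp add: powr_half_sqrt)
  have 1: "(\<lambda>n. b n * y ^ n) sums (1 / sqrt (1 + y))"
    using gen_binomial_real[of y "-1/2"] assms ps[of y] by (simp add: b_def)
  have 2: "(\<lambda>n. b n * (-y) ^ n) sums (1 / sqrt (1 - y))"
    using gen_binomial_real[of "-y" "-1/2"] assms ps[of "-y"] by (simp add: b_def)
  have "(\<lambda>n. (b n * (-y) ^ n + b n * y ^ n) / 2) sums ((1 / sqrt (1 - y) + 1 / sqrt (1 + y)) / 2)"
    by (intro sums_divide sums_add 1 2)
  moreover have "strict_mono (\<lambda>n::nat. 2 * n)"
    by (simp add: strict_mono_def)
  moreover have "(b n * (-y) ^ n + b n * y ^ n) / 2 = 0" if "n \<notin> range (\<lambda>n::nat. 2 * n)" for n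
  proof -
    have "odd n" using that by (auto elim!: evenE)
    thus ?thesis by simp
  qed
  ultimately have "(\<lambda>n. (b (2 * n) * (-y) ^ (2 * n) + b (2 * n) * y ^ (2 * n)) / 2)
      sums ((1 / sqrt (1 - y) + 1 / sqrt (1 + y)) / 2)"
    by (subst sums_mono_reindex[where g = "\<lambda>n. 2 * n"]) auto
  moreover have "(b (2 * n) * (-y) ^ (2 * n) + b (2 * n) * y ^ (2 * n)) / 2 =
      fps_hypergeo [1/4, 3/4] [1/2] 1 $ n * (y\<^sup>2) ^ n" for n
  proof -
    have num: "pochhammer (1/2) (2 * n) = 4 ^ n * pochhammer (1/4) n * pochhammer (3/4 :: real) n"
      using pochhammer_double[of "1/4 :: real" n] by (simp add: power_mult)
    have den: "fact (2 * n) = 4 ^ n * pochhammer (1/2) n * (fact n :: real)"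
      using pochhammer_double[of "1/2 :: real" n] by (simp add: power_mult pochhammer_fact)
    have "b (2 * n) = pochhammer (1/2) (2 * n) / fact (2 * n)"
      by (simp add: b_def gbinomial_pochhammer)
    hence "b (2 * n) = fps_hypergeo [1/4, 3/4] [1/2] 1 $ n"
      by (simp add: num den)
    thus ?thesis by (simp add: power_mult del: fps_hypergeo_nth)
  qed
  ultimately show ?thesis
    by (simp add: hyp2F1_def eval_fps_def sums_iff)
qed

lemma hyp_integral_has_derivative:
  assumes "0 < \<kappa>" "\<kappa> < 1"
  shows "(hyp_integral \<kappa> has_real_derivative
     (1 / sqrt (1 - \<kappa> * sin T) + 1 / sqrt (1 + \<kappa> * sin T)) / 2) (at T)"
proof -
  define F where "F = (\<lambda>t. (1 / sqrt (1 - \<kappa> * sin t) + 1 / sqrt (1 + \<kappa> * sin t)) / 2)"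
  have lt: "\<bar>\<kappa> * sin t\<bar> < 1" for t
  proof -
    have "\<bar>\<kappa> * sin t\<bar> \<le> \<kappa> * 1"
      unfolding abs_mult using assms by (intro mult_mono) auto
    thus ?thesis using assms by linarith
  qed
  have hyp: "hyp2F1 (1/4) (3/4) (1/2) (\<kappa>\<^sup>2 * (sin t)\<^sup>2) = F t" for t
    using hyp2F1_quarter_square[OF lt[of t]] by (simp add: F_def power_mult_distrib)
  have ne: "1 - \<kappa> * sin t \<noteq> 0" "1 + \<kappa> * sin t \<noteq> 0" for t
    using lt[of t] by linarith+
  define M where "M = \<bar>T\<bar> + 1"
  have cont: "continuous_on {-M..M} F"
    unfolding F_def by (intro continuous_intros) (use ne in auto)
  have "((\<lambda>u. LBINT t=0..u. F t) has_vector_derivative F T) (at T within {-M..M})"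
    using interval_integral_FTC2[of "-M" 0 M F T, OF _ _ cont] unfolding zero_ereal_def M_def by auto
  moreover have "at T within {-M..M} = at T"
    by (intro at_within_interior) (auto simp: M_def)
  ultimately show ?thesis
    by (simp add: hyp_integral_def[abs_def] hyp has_real_derivative_iff_has_vector_derivative F_def)
qed

lemma inj_hyp_integral:
  assumes "0 < \<kappa>" "\<kappa> < 1"
  shows "inj (hyp_integral \<kappa>)"
proof -
  have pos: "(1 / sqrt (1 - \<kappa> * sin t) + 1 / sqrt (1 + \<kappa> * sin t)) / 2 > 0" for t
  proof -
    have "\<bar>\<kappa> * sin t\<bar> \<le> \<kappa> * 1"
      unfolding abs_mult using assms by (intro mult_mono) auto
    hence "\<bar>\<kappa> * sin t\<bar> < 1" using assms by linarith
    thus ?thesis by (simp add: add_pos_pos)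
  qed
  have "hyp_integral \<kappa> x < hyp_integral \<kappa> y" if "x < y" for x y
    by (rule DERIV_pos_imp_increasing[OF that])
       (use hyp_integral_has_derivative[OF assms] pos in blast)
  hence "strict_mono (hyp_integral \<kappa>)" by (auto simp: strict_mono_def)
  thus ?thesis by (rule strict_mono_imp_inj_on)
qed

text \<open>
  The amplitude \<open>\<phi>\<close> is recovered from \<open>\<sigma>\<close> as \<open>\<theta> = arcsin (2 \<sigma> sqrt (1 - \<sigma>\<^sup>2) / \<kappa>)\<close>, that is, from
  \<open>\<kappa> sin \<theta> = sin (2 arcsin \<sigma>)\<close>. The differential equation for \<open>\<sigma>\<close> makes \<open>hyp_integral \<kappa> (\<theta> u)\<close> have derivative
  \<open>1\<close>, so it equals \<open>u\<close>. Injectivity of \<open>hyp_integral\<close> then identifies \<open>\<theta>\<close> with \<open>\<phi>\<close>.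
  The bound \<open>\<kappa>/2\<close> on \<open>\<sigma>\<close> keeps every \<open>arcsin\<close> inside its principal range.
\<close>

lemma rn2_real_eqI:
  fixes \<sigma> :: "real \<Rightarrow> real"
  assumes \<kappa>: "0 < \<kappa>" "\<kappa> < 1"
    and "0 < \<delta>" and "\<sigma> 0 = 0"
    and small: "\<And>u. \<bar>u\<bar> < \<delta> \<Longrightarrow> \<bar>\<sigma> u\<bar> < \<kappa> / 2"
    and deriv: "\<And>u. \<bar>u\<bar> < \<delta> \<Longrightarrow>
      (\<sigma> has_real_derivative sqrt (\<sigma> u ^ 4 - \<sigma> u ^ 2 + \<kappa>\<^sup>2 / 4)) (at u)"
    and "\<bar>u\<bar> < \<delta>"
  shows "rn2_real \<kappa> u = \<sigma> u"
proof -
  define C where "C s = sqrt (1 - s\<^sup>2)" for s :: real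
  define y where "y s = 2 * s * C s" for s :: real
  define \<theta> where "\<theta> v = arcsin (y (\<sigma> v) / \<kappa>)" for v
  \<comment> \<open>algebra of the half-angle substitution: \<open>s = sin (\<psi> / 2)\<close>, \<open>C s = cos (\<psi> / 2)\<close>, \<open>y s = sin \<psi>\<close>\<close>
  have alg: "C s > 0" "\<bar>s\<bar> < C s" "1 - y s = (C s - s)\<^sup>2" "1 + y s = (C s + s)\<^sup>2"
    "\<bar>y s\<bar> < \<kappa>" "(C s)\<^sup>2 = 1 - s\<^sup>2" if "\<bar>s\<bar> < \<kappa> / 2" for s
  proof -
    have s2: "s\<^sup>2 < 1 / 4"
      using power_strict_mono[of "\<bar>s\<bar>" "1/2" 2] that \<kappa> by (simp add: power2_eq_square)
    show C2: "(C s)\<^sup>2 = 1 - s\<^sup>2" using s2 by (simp add: C_def)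
    show Cp: "C s > 0" using s2 by (simp add: C_def)
    show "\<bar>s\<bar> < C s"
      by (rule power2_less_imp_less) (use C2 Cp s2 in auto)
    show "1 - y s = (C s - s)\<^sup>2" "1 + y s = (C s + s)\<^sup>2"
      using C2 by (simp_all add: y_def power2_eq_square algebra_simps)
    have "C s \<le> 1" by (simp add: C_def)
    hence "\<bar>y s\<bar> \<le> 2 * \<bar>s\<bar>"
      using Cp mult_left_mono[of "C s" 1 "2 * \<bar>s\<bar>"] by (simp add: y_def abs_mult)
    thus "\<bar>y s\<bar> < \<kappa>" using that by linarith
  qed
  have sin\<theta>: "\<kappa> * sin (\<theta> v) = y (\<sigma> v)" if "\<bar>v\<bar> < \<delta>" for v
  proof -
    have "\<bar>y (\<sigma> v) / \<kappa>\<bar> \<le> 1" using alg(5)[OF small[OF that]] \<kappa> by simp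
    hence "sin (\<theta> v) = y (\<sigma> v) / \<kappa>" unfolding \<theta>_def by (intro sin_arcsin) linarith+
    thus ?thesis using \<kappa> by simp
  qed
  have D: "((\<lambda>v. hyp_integral \<kappa> (\<theta> v)) has_real_derivative 1) (at v)" if "\<bar>v\<bar> < \<delta>" for v
  proof -
    define s where "s = \<sigma> v"
    define R where "R = sqrt (s ^ 4 - s\<^sup>2 + \<kappa>\<^sup>2 / 4)"
    note a = alg[OF small[OF that, folded s_def]]
    have C2: "C s * C s = 1 - s * s" using a(6) by (simp add: power2_eq_square)
    have y2: "(y s)\<^sup>2 < \<kappa>\<^sup>2"
      using a(5) \<kappa> by (metis abs_ge_zero power2_abs power_strict_mono zero_less_numeral)
    have y2': "(y s)\<^sup>2 = 4 * s\<^sup>2 * (1 - s\<^sup>2)"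
      using a(6) by (simp add: y_def power_mult_distrib)
    have eq: "sqrt (1 - (y s / \<kappa>)\<^sup>2) = 2 * R / \<kappa>"
    proof (rule real_sqrt_unique)
      have "s ^ 4 - s\<^sup>2 + \<kappa>\<^sup>2 / 4 = (\<kappa>\<^sup>2 - (y s)\<^sup>2) / 4"
        unfolding y2' by (simp add: field_simps power2_eq_square power4_eq_xxxx)
      hence R2: "R\<^sup>2 = (\<kappa>\<^sup>2 - (y s)\<^sup>2) / 4" using y2 by (simp add: R_def)
      show "(2 * R / \<kappa>)\<^sup>2 = 1 - (y s / \<kappa>)\<^sup>2"
        using \<kappa> by (simp add: power_divide power_mult_distrib R2 field_simps)
      have "s ^ 4 - s\<^sup>2 + \<kappa>\<^sup>2 / 4 \<ge> 0"
        using \<open>s ^ 4 - s\<^sup>2 + \<kappa>\<^sup>2 / 4 = _\<close> y2 by simp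
      thus "0 \<le> 2 * R / \<kappa>" using \<kappa> by (simp add: R_def)
    qed
    have Rpos: "R > 0"
    proof -
      have "1 - (y s / \<kappa>)\<^sup>2 > 0" using y2 \<kappa> by (simp add: power_divide)
      hence "2 * R / \<kappa> > 0" unfolding eq[symmetric] by simp
      thus ?thesis using \<kappa> by (simp add: zero_less_divide_iff)
    qed
    have d1: "(C has_real_derivative - s / C s) (at s)"
    proof -
      have "1 - s\<^sup>2 > 0" using a(1,6) by (metis zero_less_power)
      thus ?thesis unfolding C_def[abs_def]
        by (auto intro!: derivative_eq_intros simp: field_simps)
    qed
    have d2: "(y has_real_derivative 2 * (1 - 2 * s\<^sup>2) / C s) (at s)"
    proof -
      have "(y has_real_derivative (2 * s) * (- s / C s) + 2 * C s) (at s)"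
        unfolding y_def[abs_def] by (rule derivative_eq_intros d1 refl | simp)+
      moreover have "(2 * s) * (- s / C s) + 2 * C s = 2 * (1 - 2 * s\<^sup>2) / C s"
        using a(1) C2 by (simp add: field_simps power2_eq_square)
      ultimately show ?thesis by simp
    qed
    have d3: "((\<lambda>v. y (\<sigma> v)) has_real_derivative 2 * (1 - 2 * s\<^sup>2) / C s * R) (at v)"
      using DERIV_chain2[OF d2[unfolded s_def] deriv[OF that]] by (simp add: s_def R_def)
    have d4: "(\<theta> has_real_derivative
       inverse (sqrt (1 - (y s / \<kappa>)\<^sup>2)) * (2 * (1 - 2 * s\<^sup>2) / C s * R / \<kappa>)) (at v)"
      unfolding \<theta>_def[abs_def] s_def
    proof (rule DERIV_chain2[OF DERIV_arcsin])
      have "\<bar>y (\<sigma> v) / \<kappa>\<bar> < 1" using a(5) \<kappa> by (simp add: s_def)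
      thus "- 1 < y (\<sigma> v) / \<kappa>" "y (\<sigma> v) / \<kappa> < 1" by (simp_all only: abs_less_iff) auto
      show "((\<lambda>x. y (\<sigma> x) / \<kappa>) has_real_derivative
         2 * (1 - 2 * (\<sigma> v)\<^sup>2) / C (\<sigma> v) * R / \<kappa>) (at v)"
        using d3 unfolding s_def by (rule DERIV_cdivide)
    qed
    have d5: "(\<theta> has_real_derivative (1 - 2 * s\<^sup>2) / C s) (at v)"
    proof -
      have "inverse (2 * R / \<kappa>) * (2 * (1 - 2 * s\<^sup>2) / C s * R / \<kappa>) = (1 - 2 * s\<^sup>2) / C s"
        using Rpos \<kappa> a(1) by (simp add: field_simps)
      thus ?thesis using d4 unfolding eq by simp
    qed
    have Fv: "(1 / sqrt (1 - \<kappa> * sin (\<theta> v)) + 1 / sqrt (1 + \<kappa> * sin (\<theta> v))) / 2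
        = C s / (1 - 2 * s\<^sup>2)"
    proof -
      have p: "C s - s > 0" "C s + s > 0" using a(2) by linarith+
      have q: "(C s - s) * (C s + s) = 1 - 2 * s\<^sup>2" 
        using C2 by (simp add: algebra_simps power2_eq_square)
      have r: "sqrt (1 - \<kappa> * sin (\<theta> v)) = C s - s" "sqrt (1 + \<kappa> * sin (\<theta> v)) = C s + s"
        using p a(3,4) by (simp_all add: sin\<theta>[OF that] s_def[symmetric])
      have "1 / (C s - s) + 1 / (C s + s) = ((C s + s) + (C s - s)) / (1 - 2 * s\<^sup>2)"
        unfolding q[symmetric] using p by (subst add_frac_eq) auto
      hence "1 / (C s - s) + 1 / (C s + s) = 2 * (C s / (1 - 2 * s\<^sup>2))" by simp
      moreover have "2 * t / 2 = t" for t :: real by simp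
      ultimately show ?thesis unfolding r by (simp only:)
    qed
    have ne: "1 - 2 * s\<^sup>2 \<noteq> 0"
    proof -
      have "(C s - s) * (C s + s) = 1 - 2 * s\<^sup>2" 
        using C2 by (simp add: algebra_simps power2_eq_square)
      moreover have "(C s - s) * (C s + s) > 0" using a(2) by (intro mult_pos_pos) linarith+
      ultimately show ?thesis by simp
    qed
    show ?thesis
      using DERIV_chain2[OF hyp_integral_has_derivative[OF \<kappa>] d5] ne a(1) unfolding Fv by simp
  qed
  have "hyp_integral \<kappa> (\<theta> u) - u = hyp_integral \<kappa> (\<theta> 0) - 0"
  proof (rule DERIV_isconst3[where f = "\<lambda>v. hyp_integral \<kappa> (\<theta> v) - v" and a = "-\<delta>" and b = \<delta>])
    fix v assume "v \<in> {-\<delta><..<\<delta>}"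
    hence "\<bar>v\<bar> < \<delta>" by auto
    thus "((\<lambda>v. hyp_integral \<kappa> (\<theta> v) - v) has_real_derivative 0) (at v)"
      using DERIV_diff[OF D DERIV_ident] by fastforce
  qed (use \<open>0 < \<delta>\<close> \<open>\<bar>u\<bar> < \<delta>\<close> in auto)
  also have "\<dots> = 0"
    using \<open>\<sigma> 0 = 0\<close> by (simp add: \<theta>_def y_def hyp_integral_def zero_ereal_def[symmetric])
  finally have "rn_phi \<kappa> u = \<theta> u"
    unfolding rn_phi_def by (intro inv_f_eq inj_hyp_integral \<kappa>) simp
  hence psi: "rn_psi \<kappa> u = arcsin (y (\<sigma> u))"
    using sin\<theta>[OF \<open>\<bar>u\<bar> < \<delta>\<close>] by (simp add: rn_psi_def)
  define s where "s = \<sigma> u"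
  have s: "\<bar>s\<bar> < \<kappa> / 2" using small[OF \<open>\<bar>u\<bar> < \<delta>\<close>] by (simp add: s_def)
  hence s': "-1/2 \<le> s" "s \<le> 1/2" using \<kappa> by auto
  have half: "arcsin (1/2) = pi / 6"
    using arcsin_sin[of "pi/6"] pi_gt_zero by (simp add: sin_30)
  have up: "arcsin s \<le> pi / 6"
    using arcsin_le_arcsin[of s "1/2"] s' half by simp
  have low: "arcsin s \<ge> - (pi / 6)"
    using arcsin_le_arcsin[of "-1/2" s] s' half arcsin_minus[of "1/2"] by simp
  have "sin (2 * arcsin s) = y s"
    using s' by (simp add: sin_double y_def C_def cos_arcsin)
  hence "arcsin (y s) = 2 * arcsin s"
    using arcsin_sin[of "2 * arcsin s"] up low pi_gt_zero by simp
  thus ?thesis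
    using s' by (simp add: rn2_real_def psi s_def[symmetric])
qed

section \<open>Lattices in the complex plane\<close>

text \<open>
  Together with \<open>max a b \<ge> sqrt a * sqrt b\<close>, this bounds a double sum of \<open>max \<bar>m\<bar> \<bar>n\<bar> powr (-3)\<close> by a product of two
  convergent sums. Replacing \<open>\<bar>m\<bar>\<close> by \<open>max 1 \<bar>m\<bar>\<close> makes the terms with \<open>m = 0\<close> harmless.
\<close>

lemma summable_on_max_powr:
  "(\<lambda>m::int. max 1 (real_of_int \<bar>m\<bar>) powr (-3/2)) summable_on UNIV"
proof -
  let ?f = "\<lambda>m::int. max 1 (real_of_int \<bar>m\<bar>) powr (-3/2)"
  have "(\<lambda>n::nat. real n powr (-3/2)) summable_on UNIV"
    by (intro norm_summable_imp_summable_on) (simp add: summable_real_powr_iff)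
  hence 0: "(\<lambda>n::nat. real n powr (-3/2)) summable_on {1..}"
    by (rule summable_on_subset) auto
  have 1: "?f summable_on {1..}"
    by (rule summable_on_reindex_bij_witness[where i = nat and j = int, THEN iffD1, OF _ _ _ _ _ 0]) auto
  have 2: "?f summable_on {..-1}"
    by (rule summable_on_reindex_bij_witness[where i = uminus and j = uminus, THEN iffD1, OF _ _ _ _ _ 1]) auto
  have "?f summable_on ({1..} \<union> {..-1})"
    by (intro summable_on_Un_disjoint 1 2) auto
  hence "?f summable_on ({1..} \<union> {..-1} \<union> {0})"
    by (rule summable_on_Un_disjoint) auto
  moreover have "{1..} \<union> {..-1} \<union> {0} = (UNIV :: int set)" by auto
  ultimately show ?thesis by simp
qed

locale complex_lattice =
  fixes \<Lambda> :: "complex set"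
  assumes lattice: "is_lattice \<Lambda>"
begin

text \<open>
  With \<open>\<tau> = \<omega>\<^sub>2 / \<omega>\<^sub>1\<close>, the imaginary part of \<open>x + y \<tau>\<close> controls \<open>y\<close>, and then the triangle inequality controls \<open>x\<close>.
  Discreteness of the lattice and convergence of its sums both rest on this estimate.
\<close>

lemma norm_lower_bound:
  assumes "R_independent \<omega>\<^sub>1 \<omega>\<^sub>2"
  obtains c where "c > 0"
    "\<And>x y. max \<bar>x\<bar> \<bar>y\<bar> \<le> c * norm (of_real x * \<omega>\<^sub>1 + of_real y * \<omega>\<^sub>2)"
proof -
  define \<tau> where "\<tau> = \<omega>\<^sub>2 / \<omega>\<^sub>1"
  have Im: "Im \<tau> \<noteq> 0" and ne: "\<omega>\<^sub>1 \<noteq> 0"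
    using assms by (auto simp: R_independent_def \<tau>_def complex_is_Real_iff)
  define c where "c = (1 + (1 + norm \<tau>) / \<bar>Im \<tau>\<bar>) / norm \<omega>\<^sub>1"
  have "c > 0" using ne by (auto simp: c_def intro!: divide_pos_pos add_pos_nonneg)
  moreover have "max \<bar>x\<bar> \<bar>y\<bar> \<le> c * norm (of_real x * \<omega>\<^sub>1 + of_real y * \<omega>\<^sub>2)" for x y
  proof -
    define N where "N = norm (of_real x + of_real y * \<tau>)"
    have "of_real x * \<omega>\<^sub>1 + of_real y * \<omega>\<^sub>2 = (of_real x + of_real y * \<tau>) * \<omega>\<^sub>1"
      using ne by (simp add: \<tau>_def field_simps)
    hence eq: "norm (of_real x * \<omega>\<^sub>1 + of_real y * \<omega>\<^sub>2) = N * norm \<omega>\<^sub>1"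
      by (simp add: N_def norm_mult)
    have "\<bar>y * Im \<tau>\<bar> \<le> N"
      unfolding N_def using abs_Im_le_cmod[of "of_real x + of_real y * \<tau>"] by simp
    hence y: "\<bar>y\<bar> \<le> N / \<bar>Im \<tau>\<bar>"
      using Im by (simp add: field_simps abs_mult)
    have "\<bar>x\<bar> = norm ((of_real x + of_real y * \<tau>) - of_real y * \<tau>)" by simp
    also have "\<dots> \<le> N + \<bar>y\<bar> * norm \<tau>"
      unfolding N_def by (rule order_trans[OF norm_triangle_ineq4]) (simp add: norm_mult)
    also have "\<dots> \<le> N + N / \<bar>Im \<tau>\<bar> * norm \<tau>"
      using y by (intro add_left_mono mult_right_mono) auto
    finally have x: "\<bar>x\<bar> \<le> N + N / \<bar>Im \<tau>\<bar> * norm \<tau>" .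
    have N0: "N \<ge> 0" by (simp add: N_def)
    have "max \<bar>x\<bar> \<bar>y\<bar> \<le> N + N / \<bar>Im \<tau>\<bar> + N / \<bar>Im \<tau>\<bar> * norm \<tau>"
      using x y N0 by (auto intro!: add_nonneg_nonneg divide_nonneg_nonneg mult_nonneg_nonneg 
          intro: order_trans)
    also have "\<dots> = N * (1 + (1 + norm \<tau>) / \<bar>Im \<tau>\<bar>)"
      by (simp add: algebra_simps add_divide_distrib)
    also have "\<dots> = c * (N * norm \<omega>\<^sub>1)"
      using ne by (simp add: c_def)
    finally show ?thesis by (simp only: eq)
  qed
  ultimately show ?thesis using that by blast
qed

lemma zero_mem [simp]: "0 \<in> \<Lambda>"
  and add_mem: "a \<in> \<Lambda> \<Longrightarrow> b \<in> \<Lambda> \<Longrightarrow> a + b \<in> \<Lambda>"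
  and minus_mem: "a \<in> \<Lambda> \<Longrightarrow> - a \<in> \<Lambda>"
proof -
  obtain \<omega>\<^sub>1 \<omega>\<^sub>2 where L: "\<Lambda> = lattice_of \<omega>\<^sub>1 \<omega>\<^sub>2"
    using lattice by (auto simp: is_lattice_def)
  show "0 \<in> \<Lambda>"
    unfolding L lattice_of_def by (auto intro!: exI[of _ 0])
  show "a + b \<in> \<Lambda>" if ab: "a \<in> \<Lambda>" "b \<in> \<Lambda>"
  proof -
    obtain m n k l where "a = of_int m * \<omega>\<^sub>1 + of_int n * \<omega>\<^sub>2" "b = of_int k * \<omega>\<^sub>1 + of_int l * \<omega>\<^sub>2"
      using ab unfolding L lattice_of_def by blast
    hence "a + b = of_int (m + k) * \<omega>\<^sub>1 + of_int (n + l) * \<omega>\<^sub>2" by (simp add: algebra_simps)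
    thus ?thesis unfolding L lattice_of_def by blast
  qed
  show "- a \<in> \<Lambda>" if a: "a \<in> \<Lambda>"
  proof -
    obtain m n where "a = of_int m * \<omega>\<^sub>1 + of_int n * \<omega>\<^sub>2"
      using a unfolding L lattice_of_def by blast
    hence "- a = of_int (- m) * \<omega>\<^sub>1 + of_int (- n) * \<omega>\<^sub>2" by (simp add: algebra_simps)
    thus ?thesis unfolding L lattice_of_def by blast
  qed
qed

lemma minus_mem_iff [simp]: "- a \<in> \<Lambda> \<longleftrightarrow> a \<in> \<Lambda>"
  using minus_mem by force

lemma diff_mem: "a \<in> \<Lambda> \<Longrightarrow> b \<in> \<Lambda> \<Longrightarrow> a - b \<in> \<Lambda>"
  using add_mem[of a "- b"] by simp

lemma add_mem_iff [simp]: "b \<in> \<Lambda> \<Longrightarrow> a + b \<in> \<Lambda> \<longleftrightarrow> a \<in> \<Lambda>"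
  using add_mem[of a b] diff_mem[of "a + b" b] by auto

lemma add_mem_iff' [simp]: "b \<in> \<Lambda> \<Longrightarrow> b + a \<in> \<Lambda> \<longleftrightarrow> a \<in> \<Lambda>"
  using add_mem_iff[of b a] by (simp add: add.commute)

lemma diff_mem_iff [simp]: "b \<in> \<Lambda> \<Longrightarrow> a - b \<in> \<Lambda> \<longleftrightarrow> a \<in> \<Lambda>"
  using add_mem_iff[of "- b" a] by simp

lemma finite_bounded: "finite {\<omega>\<in>\<Lambda>. norm \<omega> < R}"
proof -
  obtain \<omega>\<^sub>1 \<omega>\<^sub>2 where ind: "R_independent \<omega>\<^sub>1 \<omega>\<^sub>2" and L: "\<Lambda> = lattice_of \<omega>\<^sub>1 \<omega>\<^sub>2"
    using lattice by (auto simp: is_lattice_def)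
  obtain c where c: "c > 0"
    "\<And>x y. max \<bar>x\<bar> \<bar>y\<bar> \<le> c * norm (of_real x * \<omega>\<^sub>1 + of_real y * \<omega>\<^sub>2)"
    using norm_lower_bound[OF ind] by blast
  define N where "N = \<lceil>c * R\<rceil>"
  have "{\<omega>\<in>\<Lambda>. norm \<omega> < R} \<subseteq> (\<lambda>(m, n). of_int m * \<omega>\<^sub>1 + of_int n * \<omega>\<^sub>2) ` ({-N..N} \<times> {-N..N})"
  proof safe
    fix \<omega> assume "\<omega> \<in> \<Lambda>" and R: "norm \<omega> < R"
    then obtain m n where mn: "\<omega> = of_int m * \<omega>\<^sub>1 + of_int n * \<omega>\<^sub>2"
      unfolding L lattice_of_def by blast
    have "max \<bar>real_of_int m\<bar> \<bar>real_of_int n\<bar> \<le> c * norm \<omega>"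
      using c(2)[of "of_int m" "of_int n"] by (simp add: mn)
    also have "\<dots> \<le> c * R" using c(1) R by (intro mult_left_mono) auto
    finally have "\<bar>real_of_int m\<bar> \<le> c * R" "\<bar>real_of_int n\<bar> \<le> c * R" by auto
    hence "m \<in> {-N..N}" "n \<in> {-N..N}"
      unfolding N_def atLeastAtMost_iff by linarith+
    thus "\<omega> \<in> (\<lambda>(m, n). of_int m * \<omega>\<^sub>1 + of_int n * \<omega>\<^sub>2) ` ({-N..N} \<times> {-N..N})"
      using mn by auto
  qed
  thus ?thesis by (rule finite_subset) auto
qed

text \<open>
  In the coordinates of a basis, \<open>norm \<omega>\<close> is bounded below by a multiple of \<open>max \<bar>m\<bar> \<bar>n\<bar>\<close>, and the sum is compared
  with a product of two sums over the integers. Since \<open>1 / 0 = 0\<close>, the term for \<open>\<omega> = 0\<close> vanishes.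
\<close>

lemma summable_inverse_cube: "(\<lambda>\<omega>. 1 / norm \<omega> ^ 3) summable_on \<Lambda>"
proof -
  obtain \<omega>\<^sub>1 \<omega>\<^sub>2 where ind: "R_independent \<omega>\<^sub>1 \<omega>\<^sub>2" and L: "\<Lambda> = lattice_of \<omega>\<^sub>1 \<omega>\<^sub>2"
    using lattice by (auto simp: is_lattice_def)
  obtain c where c: "c > 0"
    "\<And>x y. max \<bar>x\<bar> \<bar>y\<bar> \<le> c * norm (of_real x * \<omega>\<^sub>1 + of_real y * \<omega>\<^sub>2)"
    using norm_lower_bound[OF ind] by blast
  define e where "e = (\<lambda>(m, n). of_int m * \<omega>\<^sub>1 + of_int n * \<omega>\<^sub>2)"
  define p :: "int \<Rightarrow> real" where "p m = max 1 (real_of_int \<bar>m\<bar>) powr (-3/2)" for m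
  have inj: "inj e"
  proof (rule injI)
    fix a b :: "int \<times> int" assume eq: "e a = e b"
    have "e a - e b = of_real (of_int (fst a - fst b)) * \<omega>\<^sub>1 + of_real (of_int (snd a - snd b)) * \<omega>\<^sub>2"
      by (simp add: e_def case_prod_unfold algebra_simps)
    hence "max \<bar>real_of_int (fst a - fst b)\<bar> \<bar>real_of_int (snd a - snd b)\<bar> \<le> 0"
      using c(2)[of "of_int (fst a - fst b)" "of_int (snd a - snd b)"] eq by simp
    thus "a = b" by (auto simp: prod_eq_iff)
  qed
  have p: "p summable_on UNIV"
    using summable_on_max_powr by (simp add: p_def[abs_def])
  have "(\<lambda>(m, n). p m * p n) summable_on UNIV \<times> UNIV"
  proof (rule summable_on_SigmaI)
    show "((\<lambda>n. (\<lambda>(m, n). p m * p n) (m, n)) has_sum p m * infsum p UNIV) UNIV" for m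
      using has_sum_cmult_right[OF has_sum_infsum[OF p], of "p m"] by simp
    show "(\<lambda>m. p m * infsum p UNIV) summable_on UNIV"
      by (rule summable_on_cmult_left[OF p])
  qed (simp add: p_def)
  hence "(\<lambda>(m, n). c ^ 3 * (p m * p n)) summable_on UNIV"
    unfolding case_prod_unfold by (intro summable_on_cmult_right) simp
  hence "(\<lambda>x. 1 / norm (e x) ^ 3) summable_on UNIV"
  proof (rule summable_on_comparison_test)
    fix x :: "int \<times> int"
    obtain m n where x: "x = (m, n)" by (cases x)
    define a where "a = max 1 (real_of_int \<bar>m\<bar>)"
    define b where "b = max 1 (real_of_int \<bar>n\<bar>)"
    have ab: "a \<ge> 1" "b \<ge> 1" by (simp_all add: a_def b_def)
    show "1 / norm (e x) ^ 3 \<le> (case x of (m, n) \<Rightarrow> c ^ 3 * (p m * p n))"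
    proof (cases "x = 0")
      case True
      thus ?thesis by (simp add: e_def p_def c(1) less_imp_le zero_prod_def)
    next
      case False
      hence "m \<noteq> 0 \<or> n \<noteq> 0" by (auto simp: x zero_prod_def)
      hence "max a b \<le> c * norm (e x)"
        using c(2)[of "of_int m" "of_int n"] by (auto simp: x e_def a_def b_def)
      moreover have "sqrt a * sqrt b \<le> max a b"
      proof -
        have "sqrt a * sqrt b \<le> sqrt (max a b) * sqrt (max a b)"
          using ab by (intro mult_mono) auto
        thus ?thesis using ab by simp
      qed
      ultimately have le: "sqrt a * sqrt b \<le> c * norm (e x)" by linarith
      have pos: "sqrt a * sqrt b > 0" using ab by simp
      have pw: "t powr (-3/2) = 1 / sqrt t ^ 3" if "t \<ge> 1" for t :: real
      proof -
        have "t powr (-3/2) = 1 / t powr (3/2)" using powr_minus_divide[of t "3/2"] by simp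
        also have "t powr (3/2) = (t powr (1/2)) powr 3" by (simp add: powr_powr)
        also have "\<dots> = sqrt t ^ 3" using that by (simp add: powr_half_sqrt powr_numeral)
        finally show ?thesis .
      qed
      have "norm (e x) > 0" using le pos c(1) by (metis less_le_trans zero_less_mult_pos)
      moreover have "1 / norm (e x) \<le> c * (1 / (sqrt a * sqrt b))"
        using calculation le pos c(1) by (simp add: divide_simps mult_ac)
      ultimately have "(1 / norm (e x)) ^ 3 \<le> (c * (1 / (sqrt a * sqrt b))) ^ 3"
        by (intro power_mono) auto
      hence "1 / norm (e x) ^ 3 \<le> c ^ 3 * (1 / (sqrt a * sqrt b) ^ 3)"
        by (simp add: power_mult_distrib power_one_over power_divide)
      moreover have "p m = 1 / sqrt a ^ 3" "p n = 1 / sqrt b ^ 3"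
        unfolding p_def a_def[symmetric] b_def[symmetric] by (rule pw[OF ab(1)], rule pw[OF ab(2)])
      ultimately show ?thesis by (simp add: x power_mult_distrib mult.commute)
    qed
  qed simp
  hence "(\<lambda>\<omega>. 1 / norm \<omega> ^ 3) summable_on range e"
    by (subst summable_on_reindex[OF inj]) (simp add: o_def)
  moreover have "range e = \<Lambda>"
    unfolding L lattice_of_def e_def by auto
  ultimately show ?thesis by simp
qed

text \<open>
  Rounding the real coordinates of \<open>z\<close> down to integers moves \<open>z\<close> into a bounded parallelogram.
\<close>

lemma cocompact: obtains B where "\<And>z. \<exists>\<omega>\<in>\<Lambda>. norm (z - \<omega>) \<le> B"
proof -
  obtain \<omega>\<^sub>1 \<omega>\<^sub>2 where ind: "R_independent \<omega>\<^sub>1 \<omega>\<^sub>2" and L: "\<Lambda> = lattice_of \<omega>\<^sub>1 \<omega>\<^sub>2"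
    using lattice by (auto simp: is_lattice_def)
  define \<tau> where "\<tau> = \<omega>\<^sub>2 / \<omega>\<^sub>1"
  have Im: "Im \<tau> \<noteq> 0" and ne: "\<omega>\<^sub>1 \<noteq> 0"
    using ind by (auto simp: R_independent_def \<tau>_def complex_is_Real_iff)
  have "\<exists>\<omega>\<in>\<Lambda>. norm (z - \<omega>) \<le> norm \<omega>\<^sub>1 + norm \<omega>\<^sub>2" for z
  proof -
    define y where "y = Im (z / \<omega>\<^sub>1) / Im \<tau>"
    define x where "x = Re (z / \<omega>\<^sub>1) - y * Re \<tau>"
    define \<omega> where "\<omega> = of_int \<lfloor>x\<rfloor> * \<omega>\<^sub>1 + of_int \<lfloor>y\<rfloor> * \<omega>\<^sub>2"
    have "z / \<omega>\<^sub>1 = of_real x + of_real y * \<tau>"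
      using Im by (simp add: complex_eq_iff x_def y_def)
    hence "z = of_real x * \<omega>\<^sub>1 + of_real y * \<omega>\<^sub>2"
      using ne by (simp add: \<tau>_def field_simps)
    hence "z - \<omega> = of_real (x - \<lfloor>x\<rfloor>) * \<omega>\<^sub>1 + of_real (y - \<lfloor>y\<rfloor>) * \<omega>\<^sub>2"
      by (simp add: \<omega>_def algebra_simps)
    also have "norm \<dots> \<le> \<bar>x - \<lfloor>x\<rfloor>\<bar> * norm \<omega>\<^sub>1 + \<bar>y - \<lfloor>y\<rfloor>\<bar> * norm \<omega>\<^sub>2"
      by (rule order_trans[OF norm_triangle_ineq]) (simp add: norm_mult del: of_real_diff)
    also have "\<dots> \<le> 1 * norm \<omega>\<^sub>1 + 1 * norm \<omega>\<^sub>2"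
      by (intro add_mono mult_right_mono norm_ge_zero) linarith+
    finally have "norm (z - \<omega>) \<le> norm \<omega>\<^sub>1 + norm \<omega>\<^sub>2" by simp
    moreover have "\<omega> \<in> \<Lambda>" unfolding L lattice_of_def \<omega>_def by blast
    ultimately show ?thesis by blast
  qed
  thus ?thesis using that by blast
qed

lemma eventually_not_mem: "eventually (\<lambda>w. w \<notin> \<Lambda>) (at z)"
proof -
  have "\<not> z islimpt {\<omega>\<in>\<Lambda>. norm \<omega> < norm z + 1}"
    using finite_bounded by (rule islimpt_finite)
  hence "eventually (\<lambda>w. w \<notin> {\<omega>\<in>\<Lambda>. norm \<omega> < norm z + 1}) (at z)"
    by (simp add: islimpt_iff_eventually)
  moreover have "eventually (\<lambda>w. w \<in> ball 0 (norm z + 1)) (at z)"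
    by (intro eventually_at_in_open') auto
  ultimately show ?thesis by eventually_elim auto
qed

lemma closed: "closed \<Lambda>"
  unfolding closed_limpt islimpt_iff_eventually using eventually_not_mem by blast

lemma countable: "countable \<Lambda>"
proof -
  have "\<Lambda> \<subseteq> (\<Union>n::nat. {\<omega>\<in>\<Lambda>. norm \<omega> < real n})"
  proof
    fix \<omega> assume "\<omega> \<in> \<Lambda>"
    moreover obtain n :: nat where "norm \<omega> < real n" using reals_Archimedean2 by blast
    ultimately show "\<omega> \<in> (\<Union>n::nat. {\<omega>\<in>\<Lambda>. norm \<omega> < real n})" by auto
  qed
  moreover have "countable (\<Union>n::nat. {\<omega>\<in>\<Lambda>. norm \<omega> < real n})"
    by (rule countable_UN) (auto intro: countable_finite finite_bounded)
  ultimately show ?thesis by (rule countable_subset)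
qed

text \<open>
  Once its removable singularities are filled in, the function is entire; by periodicity all its values are
  taken on a compact disc, so Liouville's theorem applies. The function itself may differ from the constant at
  isolated points.
\<close>

lemma elliptic_without_poles_const:
  assumes mero: "f meromorphic_on UNIV"
    and periodic: "\<And>z \<omega>. \<omega> \<in> \<Lambda> \<Longrightarrow> f (z + \<omega>) = f z"
    and no_pole: "\<And>z. \<not> is_pole f z"
  obtains c where "\<And>z. remove_sings f z = c"
proof -
  have mero': "f meromorphic_on {z}" for z using mero meromorphic_on_subset by blast
  have an: "remove_sings f analytic_on {z}" for z
  proof -
    obtain c where "f \<midarrow>z\<rightarrow> c"
      using meromorphic_on_not_essential[OF mero'] no_pole unfolding not_essential_def by blast
    thus ?thesis
      by (intro remove_sings_analytic_at meromorphic_on_isolated_singularity mero')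
  qed
  have holo: "remove_sings f holomorphic_on UNIV"
    using an analytic_on_analytic_at[of _ UNIV] analytic_imp_holomorphic by blast
  have per: "remove_sings f (z + \<omega>) = remove_sings f z" if "\<omega> \<in> \<Lambda>" for z \<omega>
  proof -
    have "f \<midarrow>z + \<omega>\<rightarrow> c \<longleftrightarrow> f \<midarrow>z\<rightarrow> c" for c
    proof -
      have "f \<midarrow>z + \<omega>\<rightarrow> c \<longleftrightarrow> (\<lambda>w. f (w + \<omega>)) \<midarrow>z\<rightarrow> c"
        unfolding at_to_0[of "z + \<omega>"] at_to_0[of z] filterlim_filtermap by (simp add: add_ac)
      thus ?thesis using periodic[OF that] by simp
    qed
    thus ?thesis unfolding remove_sings_def t2_space_class.Lim_def by simp
  qed
  obtain B where B: "\<And>z. \<exists>\<omega>\<in>\<Lambda>. norm (z - \<omega>) \<le> B" using cocompact by blast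
  have "range (remove_sings f) \<subseteq> remove_sings f ` cball 0 B"
  proof safe
    fix z
    obtain \<omega> where \<omega>: "\<omega> \<in> \<Lambda>" "norm (z - \<omega>) \<le> B" using B by blast
    thus "remove_sings f z \<in> remove_sings f ` cball 0 B"
      using per[OF \<omega>(1), of "z - \<omega>"] by (intro image_eqI[of _ _ "z - \<omega>"]) auto
  qed
  moreover have "bounded (remove_sings f ` cball 0 B)"
    by (intro compact_imp_bounded compact_continuous_image holomorphic_on_imp_continuous_on)
       (use holo holomorphic_on_subset in auto)
  ultimately have "bounded (range (remove_sings f))" by (rule bounded_subset[rotated])
  from Liouville_theorem[OF holo this] show ?thesis
    using that unfolding constant_on_def by auto
qed

end

section \<open>The Weierstrass function of a lattice\<close>

text \<open>
  Weierstrass' theorem for sums over arbitrary index sets.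
\<close>

lemma normally_convergent_sum:
  fixes f :: "'i \<Rightarrow> complex \<Rightarrow> complex"
  assumes U: "open U"
    and holo: "\<And>i. i \<in> I \<Longrightarrow> f i holomorphic_on U"
    and bound: "\<And>i z. i \<in> I \<Longrightarrow> z \<in> U \<Longrightarrow> norm (f i z) \<le> M i"
    and M: "M summable_on I"
  shows normally_convergent_sum_holomorphic: "(\<lambda>z. \<Sum>\<^sub>\<infinity>i\<in>I. f i z) holomorphic_on U"
    and normally_convergent_sum_deriv: 
      "z \<in> U \<Longrightarrow> ((\<lambda>i. deriv (f i) z) has_sum deriv (\<lambda>z. \<Sum>\<^sub>\<infinity>i\<in>I. f i z) z) I"
proof -
  let ?g = "\<lambda>z. \<Sum>\<^sub>\<infinity>i\<in>I. f i z"
  have main: "\<exists>d. (?g has_field_derivative d) (at z) \<and> ((\<lambda>i. deriv (f i) z) has_sum d) I"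
    if z: "z \<in> U" for z
  proof -
    obtain r where r: "r > 0" "cball z r \<subseteq> U"
      using U z by (meson open_contains_cball)
    have fd: "(f i has_field_derivative deriv (f i) w) (at w)" if "i \<in> I" "w \<in> U" for i w
      using holo[OF that(1)] U that(2) by (rule holomorphic_derivI)
    have lim: "uniform_limit (cball z r) (\<lambda>X w. \<Sum>i\<in>X. f i w) ?g (finite_subsets_at_top I)"
      by (rule Weierstrass_m_test_general[OF _ M]) (use bound r in blast)
    have "\<forall>\<^sub>F X in finite_subsets_at_top I. continuous_on (cball z r) (\<lambda>w. \<Sum>i\<in>X. f i w) \<and>
        (\<forall>w\<in>ball z r. ((\<lambda>w. \<Sum>i\<in>X. f i w) has_field_derivative (\<Sum>i\<in>X. deriv (f i) w)) (at w))"
    proof (rule eventually_finite_subsets_at_top_weakI, intro conjI ballI)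
      fix X assume X: "finite X" "X \<subseteq> I"
      show "continuous_on (cball z r) (\<lambda>w. \<Sum>i\<in>X. f i w)"
        using X r holo by (intro continuous_on_sum)
          (meson holomorphic_on_imp_continuous_on continuous_on_subset subsetD)
      show "((\<lambda>w. \<Sum>i\<in>X. f i w) has_field_derivative (\<Sum>i\<in>X. deriv (f i) w)) (at w)"
        if "w \<in> ball z r" for w
        using X r that by (intro DERIV_sum fd) auto
    qed
    from has_complex_derivative_uniform_limit[OF this lim _ r(1)]
    obtain g' where "\<And>w. w \<in> ball z r \<Longrightarrow> (?g has_field_derivative g' w) (at w) \<and>
        ((\<lambda>X. \<Sum>i\<in>X. deriv (f i) w) \<longlongrightarrow> g' w) (finite_subsets_at_top I)"
      using finite_subsets_at_top_neq_bot by blast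
    from this[of z] r(1) show ?thesis unfolding has_sum_def by auto
  qed
  show "?g holomorphic_on U"
    unfolding holomorphic_on_open[OF U] using main by blast
  show "((\<lambda>i. deriv (f i) z) has_sum deriv ?g z) I" if "z \<in> U"
    using main[OF that] DERIV_imp_deriv by blast
qed

context complex_lattice
begin

text \<open>
  For \<open>\<omega> = 0\<close> this is \<open>1 / z\<^sup>2\<close>, because \<open>1 / 0 = 0\<close>, so that \<open>\<wp>\<close> is one sum over the whole lattice.
\<close>

definition wp_term :: "complex \<Rightarrow> complex \<Rightarrow> complex" where
  "wp_term \<omega> z = 1 / (z - \<omega>)\<^sup>2 - 1 / \<omega>\<^sup>2"

text \<open>
  On the disc of radius \<open>R\<close>, the terms of these lattice points have no poles and converge normally, while only
  finitely many lattice points are left out.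
\<close>

definition far :: "real \<Rightarrow> complex set" where
  "far R = {\<omega>\<in>\<Lambda>. 2 * R \<le> norm \<omega>}"

abbreviation P :: "complex \<Rightarrow> complex" where "P \<equiv> weierstrass_p \<Lambda>"

lemma far_diff_nonzero:
  assumes "R > 0" "\<omega> \<in> far R" "norm z < R"
  shows "norm \<omega> / 2 \<le> norm (z - \<omega>)" "z - \<omega> \<noteq> 0" "\<omega> \<noteq> 0"
proof -
  have "norm \<omega> \<le> norm (z - \<omega>) + norm z"
    using norm_triangle_ineq4[of z "z - \<omega>"] by simp
  thus 1: "norm \<omega> / 2 \<le> norm (z - \<omega>)" using assms by (simp add: far_def)
  show "\<omega> \<noteq> 0" using assms by (auto simp: far_def)
  thus "z - \<omega> \<noteq> 0" using 1 by auto
qed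

lemma wp_term_bound:
  assumes "R > 0" "\<omega> \<in> far R" "norm z < R"
  shows "norm (wp_term \<omega> z) \<le> 10 * R * (1 / norm \<omega> ^ 3)"
proof -
  note n = far_diff_nonzero[OF assms]
  have "wp_term \<omega> z = (\<omega>\<^sup>2 - (z - \<omega>)\<^sup>2) / ((z - \<omega>)\<^sup>2 * \<omega>\<^sup>2)"
    using n by (simp add: wp_term_def diff_frac_eq)
  also have "\<omega>\<^sup>2 - (z - \<omega>)\<^sup>2 = z * (2 * \<omega> - z)"
    by (simp add: power2_eq_square algebra_simps)
  also have "z * (2 * \<omega> - z) / ((z - \<omega>)\<^sup>2 * \<omega>\<^sup>2) = z * (2 * \<omega> - z) / (z - \<omega>)\<^sup>2 / \<omega>\<^sup>2"
    by simp
  also have "norm \<dots> = norm z * norm (2 * \<omega> - z) / (norm (z - \<omega>))\<^sup>2 / (norm \<omega>)\<^sup>2"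
    by (simp add: norm_mult norm_divide norm_power)
  also have "\<dots> \<le> R * (5 / 2 * norm \<omega>) / (norm \<omega> / 2)\<^sup>2 / (norm \<omega>)\<^sup>2"
  proof (intro divide_right_mono frac_le mult_mono power_mono)
    have "norm (2 * \<omega> - z) \<le> 2 * norm \<omega> + norm z"
      by (rule order_trans[OF norm_triangle_ineq4]) (simp add: norm_mult)
    thus "norm (2 * \<omega> - z) \<le> 5 / 2 * norm \<omega>" using assms by (simp add: far_def)
  qed (use assms n in auto)
  also have "\<dots> = 10 * R * (1 / norm \<omega> ^ 3)"
    using n by (simp add: field_simps power2_eq_square power3_eq_cube)
  finally show ?thesis .
qed

lemma summable_far: "(\<lambda>\<omega>. c * (1 / norm \<omega> ^ 3)) summable_on far R"
  using summable_on_subset[OF summable_inverse_cube, of "far R"]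
  by (intro summable_on_cmult_right) (auto simp: far_def)

lemma wp_term_holomorphic: "\<omega> \<notin> U \<Longrightarrow> wp_term \<omega> holomorphic_on U"
  unfolding wp_term_def[abs_def] by (auto intro!: holomorphic_intros)

lemma deriv_wp_term:
  assumes "z \<noteq> \<omega>"
  shows "deriv (wp_term \<omega>) z = - 2 / (z - \<omega>) ^ 3"
proof -
  define d where "d = z - \<omega>"
  have "d \<noteq> 0" using assms by (simp add: d_def)
  have "((\<lambda>z. (z - \<omega>)\<^sup>2) has_field_derivative 2 * d) (at z)"
    unfolding d_def by (auto intro!: derivative_eq_intros)
  hence "((\<lambda>z. inverse ((z - \<omega>)\<^sup>2)) has_field_derivative - (inverse (d\<^sup>2) * (2 * d) * inverse (d\<^sup>2))) (at z)"
    using DERIV_inverse' assms unfolding d_def by fastforce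
  moreover have "- (inverse (d\<^sup>2) * (2 * d) * inverse (d\<^sup>2)) = - 2 / d ^ 3"
    using \<open>d \<noteq> 0\<close> by (simp add: field_simps power2_eq_square power3_eq_cube)
  ultimately have "((\<lambda>z. 1 / (z - \<omega>)\<^sup>2 - 1 / \<omega>\<^sup>2) has_field_derivative - 2 / (z - \<omega>) ^ 3 - 0) (at z)"
    by (intro DERIV_diff DERIV_const) (simp add: d_def inverse_eq_divide)
  hence "((\<lambda>z. 1 / (z - \<omega>)\<^sup>2 - 1 / \<omega>\<^sup>2) has_field_derivative - 2 / (z - \<omega>) ^ 3) (at z)" by simp
  thus ?thesis
    unfolding wp_term_def[abs_def] by (rule DERIV_imp_deriv)
qed

lemma far_sum:
  assumes "R > 0"
  shows far_sum_holomorphic: "(\<lambda>z. \<Sum>\<^sub>\<infinity>\<omega>\<in>far R. wp_term \<omega> z) holomorphic_on ball 0 R"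
    and far_sum_deriv: "z \<in> ball 0 R \<Longrightarrow> ((\<lambda>\<omega>. deriv (wp_term \<omega>) z) has_sum 
      deriv (\<lambda>z. \<Sum>\<^sub>\<infinity>\<omega>\<in>far R. wp_term \<omega> z) z) (far R)"
proof -
  have h: "wp_term \<omega> holomorphic_on ball 0 R" if "\<omega> \<in> far R" for \<omega>
    by (rule wp_term_holomorphic) (use that assms in \<open>auto simp: far_def\<close>)
  have b: "norm (wp_term \<omega> z) \<le> 10 * R * (1 / norm \<omega> ^ 3)" 
    if "\<omega> \<in> far R" "z \<in> ball 0 R" for \<omega> z
    using wp_term_bound[OF assms] that by simp
  note * = open_ball h b summable_far
  show "(\<lambda>z. \<Sum>\<^sub>\<infinity>\<omega>\<in>far R. wp_term \<omega> z) holomorphic_on ball 0 R"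
    by (rule normally_convergent_sum_holomorphic[OF *])
  show "z \<in> ball 0 R \<Longrightarrow> ((\<lambda>\<omega>. deriv (wp_term \<omega>) z) has_sum 
      deriv (\<lambda>z. \<Sum>\<^sub>\<infinity>\<omega>\<in>far R. wp_term \<omega> z) z) (far R)"
    by (rule normally_convergent_sum_deriv[OF *])
qed

lemma lattice_split:
  "\<Lambda> = {\<omega>\<in>\<Lambda>. norm \<omega> < 2 * R} \<union> far R" "{\<omega>\<in>\<Lambda>. norm \<omega> < 2 * R} \<inter> far R = {}"
  by (auto simp: far_def)

lemma wp_term_summable: "(\<lambda>\<omega>. wp_term \<omega> z) summable_on \<Lambda>"
proof -
  define R where "R = norm z + 1"
  have R: "R > 0" "norm z < R" by (auto simp: R_def add_nonneg_pos)
  have "(\<lambda>\<omega>. wp_term \<omega> z) summable_on far R"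
  proof (rule abs_summable_summable, rule Infinite_Sum.abs_summable_on_comparison_test')
    show "(\<lambda>\<omega>. 10 * R * (1 / norm \<omega> ^ 3)) summable_on far R" by (rule summable_far)
  qed (use wp_term_bound[OF R(1) _ R(2)] in auto)
  moreover have "(\<lambda>\<omega>. wp_term \<omega> z) summable_on {\<omega>\<in>\<Lambda>. norm \<omega> < 2 * R}"
    by (intro summable_on_finite finite_bounded)
  ultimately show ?thesis
    using lattice_split[of R] summable_on_Un_disjoint by metis
qed

lemma P_eq_infsum:
  assumes "z \<notin> \<Lambda>"
  shows "P z = (\<Sum>\<^sub>\<infinity>\<omega>\<in>\<Lambda>. wp_term \<omega> z)"
proof -
  have "(\<Sum>\<^sub>\<infinity>\<omega>\<in>{0} \<union> (\<Lambda> - {0}). wp_term \<omega> z) = wp_term 0 z + (\<Sum>\<^sub>\<infinity>\<omega>\<in>\<Lambda> - {0}. wp_term \<omega> z)"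
    using summable_on_subset[OF wp_term_summable, of "\<Lambda> - {0}"]
    by (subst infsum_Un_disjoint) auto
  moreover have "{0} \<union> (\<Lambda> - {0}) = \<Lambda>" by auto
  ultimately show ?thesis
    using assms by (simp add: weierstrass_p_def wp_term_def)
qed

lemma P_split:
  assumes "z \<notin> \<Lambda>"
  shows "P z = (\<Sum>\<omega>\<in>{\<omega>\<in>\<Lambda>. norm \<omega> < 2 * R}. wp_term \<omega> z) + (\<Sum>\<^sub>\<infinity>\<omega>\<in>far R. wp_term \<omega> z)"
proof -
  have "(\<Sum>\<^sub>\<infinity>\<omega>\<in>\<Lambda>. wp_term \<omega> z) = (\<Sum>\<^sub>\<infinity>\<omega>\<in>{\<omega>\<in>\<Lambda>. norm \<omega> < 2 * R}. wp_term \<omega> z) 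
      + (\<Sum>\<^sub>\<infinity>\<omega>\<in>far R. wp_term \<omega> z)"
    using summable_on_subset[OF wp_term_summable, of _ z] lattice_split[of R]
    by (metis (no_types, lifting) Un_upper1 Un_upper2 infsum_Un_disjoint)
  thus ?thesis using finite_bounded[of "2 * R"] by (simp add: P_eq_infsum[OF assms])
qed

lemma open_compl: "open (- \<Lambda>)"
  using closed by (simp add: open_Compl)

lemma P_has_derivative_and_sum:
  assumes z: "z \<notin> \<Lambda>"
  shows P_field_differentiable: "P field_differentiable (at z)"
    and deriv_P_has_sum: "((\<lambda>\<omega>. - 2 / (z - \<omega>) ^ 3) has_sum deriv P z) \<Lambda>"
proof -
  define R where "R = norm z + 1"
  have R: "R > 0" "z \<in> ball 0 R" by (auto simp: R_def add_nonneg_pos)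
  define near where "near = {\<omega>\<in>\<Lambda>. norm \<omega> < 2 * R}"
  have fin: "finite near" by (simp add: near_def finite_bounded)
  let ?U = "ball 0 R - \<Lambda>"
  have U: "open ?U" "z \<in> ?U" using R z closed by auto
  let ?N = "\<lambda>w. \<Sum>\<omega>\<in>near. wp_term \<omega> w"
  let ?T = "\<lambda>w. \<Sum>\<^sub>\<infinity>\<omega>\<in>far R. wp_term \<omega> w"
  have ne: "z \<noteq> \<omega>" if "\<omega> \<in> \<Lambda>" for \<omega> using that z by auto
  have N: "(?N has_field_derivative (\<Sum>\<omega>\<in>near. deriv (wp_term \<omega>) z)) (at z)"
  proof (rule DERIV_sum)
    fix \<omega> assume "\<omega> \<in> near"
    hence "wp_term \<omega> holomorphic_on ?U"
      by (intro wp_term_holomorphic) (auto simp: near_def)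
    thus "(wp_term \<omega> has_field_derivative deriv (wp_term \<omega>) z) (at z)"
      using U by (rule holomorphic_derivI)
  qed
  have T: "(?T has_field_derivative deriv ?T z) (at z)"
    using far_sum_holomorphic[OF R(1)] open_ball R(2) by (rule holomorphic_derivI)
  have "((\<lambda>w. ?N w + ?T w) has_field_derivative (\<Sum>\<omega>\<in>near. deriv (wp_term \<omega>) z) + deriv ?T z) (at z)"
    by (rule DERIV_add[OF N T])
  hence D: "(P has_field_derivative (\<Sum>\<omega>\<in>near. deriv (wp_term \<omega>) z) + deriv ?T z) (at z)"
    by (rule has_field_derivative_transform_within_open[OF _ U])
       (use P_split[of _ R] in \<open>auto simp: near_def\<close>)
  thus "P field_differentiable (at z)" by (auto simp: field_differentiable_def)
  have "((\<lambda>\<omega>. deriv (wp_term \<omega>) z) has_sum (\<Sum>\<omega>\<in>near. deriv (wp_term \<omega>) z) + deriv ?T z) (near \<union> far R)"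
    by (rule has_sum_Un_disjoint[OF has_sum_finite[OF fin] far_sum_deriv[OF R]])
       (use lattice_split[of R] in \<open>auto simp: near_def\<close>)
  moreover have "near \<union> far R = \<Lambda>" using lattice_split[of R] by (simp add: near_def)
  ultimately have "((\<lambda>\<omega>. deriv (wp_term \<omega>) z) has_sum deriv P z) \<Lambda>"
    using DERIV_imp_deriv[OF D] by simp
  thus "((\<lambda>\<omega>. - 2 / (z - \<omega>) ^ 3) has_sum deriv P z) \<Lambda>"
    by (rule has_sum_cong[THEN iffD1, rotated]) (use ne deriv_wp_term in auto)
qed

lemma P_holomorphic: "P holomorphic_on - \<Lambda>"
  using P_field_differentiable field_differentiable_at_within
  by (auto simp: holomorphic_on_def)

lemma P_minus: "P (- z) = P z"
proof (cases "z \<in> \<Lambda>")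
  case False
  have "(\<Sum>\<^sub>\<infinity>\<omega>\<in>\<Lambda>. wp_term \<omega> (- z)) = (\<Sum>\<^sub>\<infinity>\<omega>\<in>\<Lambda>. wp_term \<omega> z)"
  proof (rule infsum_reindex_bij_witness[of _ uminus uminus])
    fix \<omega>
    have "(- z - \<omega>)\<^sup>2 = (z - - \<omega>)\<^sup>2" by (simp add: power2_eq_square algebra_simps)
    thus "wp_term (- \<omega>) z = wp_term \<omega> (- z)" by (simp add: wp_term_def)
  qed auto
  thus ?thesis using False by (simp add: P_eq_infsum)
qed (simp add: weierstrass_p_def)

text \<open>
  Unlike the series of \<open>\<wp>\<close>, the differentiated series has no correction terms, so translation by \<open>\<omega>\<close> merely permutes
  its terms.
\<close>

lemma deriv_P_periodic:
  assumes "\<omega> \<in> \<Lambda>" "z \<notin> \<Lambda>"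
  shows "deriv P (z + \<omega>) = deriv P z"
proof -
  have "((\<lambda>a. - 2 / (z - a) ^ 3) has_sum deriv P (z + \<omega>)) \<Lambda>"
    by (rule has_sum_reindex_bij_witness[where i = "\<lambda>a. a + \<omega>" and j = "\<lambda>a. a - \<omega>", 
          THEN iffD1, OF _ _ _ _ _ _ deriv_P_has_sum[of "z + \<omega>"]])
       (use assms in \<open>auto simp: algebra_simps\<close>)
  thus ?thesis using deriv_P_has_sum[OF assms(2)] has_sum_unique by blast
qed

text \<open>
  The derivative is periodic, so \<open>\<wp>(z + \<omega>) - \<wp>(z)\<close> is a constant on the connected complement of the lattice.
  As \<open>\<wp>\<close> is even, replacing \<open>z\<close> by \<open>-z - \<omega>\<close> changes the sign of this constant, which is therefore \<open>0\<close>.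
\<close>

lemma P_periodic:
  assumes \<omega>: "\<omega> \<in> \<Lambda>"
  shows "P (z + \<omega>) = P z"
proof (cases "z \<in> \<Lambda>")
  case False
  have "((\<lambda>w. P (w + \<omega>) - P w) has_field_derivative 0) (at w)" if w: "w \<in> - \<Lambda>" for w
  proof -
    have "(P has_field_derivative deriv P (w + \<omega>)) (at (w + \<omega>))"
      using P_field_differentiable[of "w + \<omega>"] w \<omega> field_differentiable_derivI by auto
    hence "((\<lambda>w. P (w + \<omega>)) has_field_derivative deriv P (w + \<omega>)) (at w)"
      by (simp add: DERIV_shift)
    moreover have "(P has_field_derivative deriv P w) (at w)"
      using P_field_differentiable[of w] w field_differentiable_derivI by auto
    ultimately show ?thesis
      using deriv_P_periodic[OF \<omega>, of w] w by (auto intro: derivative_eq_intros)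
  qed
  moreover have "connected (- \<Lambda>)"
    by (intro path_connected_imp_connected path_connected_complement_countable countable) simp
  ultimately have "(\<lambda>w. P (w + \<omega>) - P w) constant_on - \<Lambda>"
    using open_compl by (intro has_field_derivative_0_imp_constant_on)
  then obtain c where c: "\<And>w. w \<in> - \<Lambda> \<Longrightarrow> P (w + \<omega>) - P w = c"
    by (auto simp: constant_on_def)
  have "P (- z - \<omega> + \<omega>) - P (- z - \<omega>) = c" using False \<omega> by (intro c) simp
  moreover have "P (- z - \<omega>) = P (z + \<omega>)" using P_minus[of "z + \<omega>"] by simp
  ultimately have "P z - P (z + \<omega>) = c" using P_minus[of z] by simp
  moreover have "P (z + \<omega>) - P z = c" using c[of z] False by simp
  moreover have "2 * (P (z + \<omega>) - P z) = (P (z + \<omega>) - P z) - (P z - P (z + \<omega>))"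
    by (simp add: algebra_simps)
  ultimately have "2 * (P (z + \<omega>) - P z) = 0" by simp
  thus ?thesis by simp
qed (use assms in \<open>simp add: weierstrass_p_def\<close>)

end

lemma analytic_imp_not_pole: "f analytic_on {z} \<Longrightarrow> \<not> is_pole f z"
  by (metis analytic_at not_is_pole_holomorphic)

context complex_lattice
begin

text \<open>
  The remainder of \<open>\<Sum>k\<ge>1. (k + 1) z\<^sup>k / \<omega> ^ (k + 2)\<close>, the expansion of a term of \<open>\<wp>\<close>, after four terms, divided by \<open>z ^ 5\<close>.
\<close>

definition wp_remainder :: "complex \<Rightarrow> complex \<Rightarrow> complex" where
  "wp_remainder \<omega> z = (6 * \<omega> - 5 * z) / (\<omega> ^ 6 * (z - \<omega>)\<^sup>2)"

lemma wp_term_expansion: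
  assumes "\<omega> \<noteq> 0" "z \<noteq> \<omega>"
  shows "wp_term \<omega> z = 2 * z * (1 / \<omega> ^ 3) + 3 * z ^ 2 * (1 / \<omega> ^ 4) + 4 * z ^ 3 * (1 / \<omega> ^ 5)
           + 5 * z ^ 4 * (1 / \<omega> ^ 6) + z ^ 5 * wp_remainder \<omega> z"
proof -
  define d where "d = z - \<omega>"
  have d: "d \<noteq> 0" using assms by (simp add: d_def)
  have "\<omega> ^ 6 * d\<^sup>2 * wp_term \<omega> z = \<omega> ^ 6 - \<omega> ^ 4 * d\<^sup>2"
    using assms(1) d unfolding wp_term_def d_def[symmetric]
    by (simp add: right_diff_distrib divide_simps) (simp add: power_numeral_reduce algebra_simps)
  also have "\<dots> = 2 * z * \<omega> ^ 3 * d\<^sup>2 + 3 * z ^ 2 * \<omega> ^ 2 * d\<^sup>2 + 4 * z ^ 3 * \<omega> * d\<^sup>2 + 5 * z ^ 4 * d\<^sup>2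
      + z ^ 5 * (6 * \<omega> - 5 * z)"
    unfolding d_def by algebra
  also have "\<dots> = \<omega> ^ 6 * d\<^sup>2 * (2 * z * (1 / \<omega> ^ 3) + 3 * z ^ 2 * (1 / \<omega> ^ 4) + 4 * z ^ 3 * (1 / \<omega> ^ 5)
           + 5 * z ^ 4 * (1 / \<omega> ^ 6) + z ^ 5 * wp_remainder \<omega> z)"
    using assms(1) d unfolding wp_remainder_def d_def[symmetric]
    by (simp add: distrib_left power_numeral_reduce)
  finally show ?thesis using assms(1) d by (simp only: mult_cancel_left) simp
qed

lemma inverse_power_summable:
  assumes r: "r > 0" "far r = \<Lambda> - {0}" and k: "k \<ge> 3"
  shows "(\<lambda>\<omega>. 1 / \<omega> ^ k) summable_on \<Lambda> - {0}"
proof (rule abs_summable_summable, rule Infinite_Sum.abs_summable_on_comparison_test')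
  show "(\<lambda>\<omega>. (1 / (2 * r) ^ (k - 3)) * (1 / norm \<omega> ^ 3)) summable_on \<Lambda> - {0}"
    using summable_far[of _ r] by (simp only: r(2))
  fix \<omega> assume "\<omega> \<in> \<Lambda> - {0}"
  hence \<omega>: "2 * r \<le> norm \<omega>" using r(2) by (auto simp: far_def)
  have "norm \<omega> ^ k = norm \<omega> ^ (k - 3) * norm \<omega> ^ 3"
    using k by (simp add: power_add[symmetric])
  also have "\<dots> \<ge> (2 * r) ^ (k - 3) * norm \<omega> ^ 3"
    using \<omega> r(1) by (intro mult_right_mono power_mono) auto
  finally have "1 / norm \<omega> ^ k \<le> 1 / ((2 * r) ^ (k - 3) * norm \<omega> ^ 3)"
    using \<omega> r(1) by (intro divide_left_mono mult_pos_pos zero_less_power) auto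
  thus "norm (1 / \<omega> ^ k) \<le> (1 / (2 * r) ^ (k - 3)) * (1 / norm \<omega> ^ 3)"
    by (simp add: norm_divide norm_power)
qed

lemma odd_inverse_power_sum:
  assumes "odd k"
  shows "(\<Sum>\<^sub>\<infinity>\<omega>\<in>\<Lambda> - {0}. 1 / \<omega> ^ k) = 0"
proof -
  have "(\<Sum>\<^sub>\<infinity>\<omega>\<in>\<Lambda> - {0}. 1 / \<omega> ^ k) = (\<Sum>\<^sub>\<infinity>\<omega>\<in>\<Lambda> - {0}. - (1 / \<omega> ^ k))"
    by (rule infsum_reindex_bij_witness[of _ uminus uminus]) (use assms in auto)
  also have "\<dots> = - (\<Sum>\<^sub>\<infinity>\<omega>\<in>\<Lambda> - {0}. 1 / \<omega> ^ k)"
    by (rule infsum_uminus)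
  finally have "2 * (\<Sum>\<^sub>\<infinity>\<omega>\<in>\<Lambda> - {0}. 1 / \<omega> ^ k) = 0" by simp
  thus ?thesis by simp
qed

text \<open>
  Summing the expansions of the terms over the lattice, the sums of odd powers vanish by symmetry, and those of
  the fourth and sixth powers are multiples of the two invariants. The error term \<open>z ^ 5 * Q z\<close> is small enough for the
  derivation of the differential equation.
\<close>

lemma P_expansion:
  obtains r Q where "r > 0" "Q holomorphic_on ball 0 r"
    "\<And>z. z \<in> ball 0 r - {0} \<Longrightarrow>
       P z = 1 / z\<^sup>2 + lattice_g2 \<Lambda> / 20 * z\<^sup>2 + lattice_g3 \<Lambda> / 28 * z ^ 4 + z ^ 5 * Q z"
    "\<And>z. z \<in> ball 0 r - {0} \<Longrightarrow>
       deriv P z = - 2 / z ^ 3 + lattice_g2 \<Lambda> / 10 * z + lattice_g3 \<Lambda> / 7 * z ^ 3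
         + (5 * z ^ 4 * Q z + z ^ 5 * deriv Q z)"
proof -
  obtain d where d: "d > 0" "\<And>w. w \<noteq> 0 \<Longrightarrow> norm w < d \<Longrightarrow> w \<notin> \<Lambda>"
    using eventually_not_mem[of 0] by (auto simp: eventually_at)
  define r where "r = d / 2"
  have r: "r > 0" using d by (simp add: r_def)
  have far: "far r = \<Lambda> - {0}"
    using d by (force simp: far_def r_def)
  define Q where "Q z = (\<Sum>\<^sub>\<infinity>\<omega>\<in>far r. wp_remainder \<omega> z)" for z
  have bound: "norm (wp_remainder \<omega> z) \<le> 34 / (2 * r) ^ 4 * (1 / norm \<omega> ^ 3)"
    if \<omega>: "\<omega> \<in> far r" and z: "z \<in> ball 0 r" for \<omega> z
  proof -
    have z': "norm z < r" using z by simp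
    note n = far_diff_nonzero[OF r \<omega> z']
    have \<omega>': "2 * r \<le> norm \<omega>" using \<omega> by (simp add: far_def)
    have "norm (6 * \<omega> - 5 * z) \<le> 6 * norm \<omega> + 5 * norm z"
      by (rule order_trans[OF norm_triangle_ineq4]) (simp add: norm_mult)
    hence 1: "norm (6 * \<omega> - 5 * z) \<le> 17 / 2 * norm \<omega>" using z' \<omega>' by simp
    have "norm (wp_remainder \<omega> z) = norm (6 * \<omega> - 5 * z) / (norm \<omega> ^ 6 * (norm (z - \<omega>))\<^sup>2)"
      by (simp add: wp_remainder_def norm_divide norm_mult norm_power)
    also have "\<dots> \<le> (17 / 2 * norm \<omega>) / (norm \<omega> ^ 6 * (norm \<omega> / 2)\<^sup>2)"
      using n 1 by (intro frac_le mult_left_mono power_mono mult_pos_pos) auto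
    also have "\<dots> = 34 / (norm \<omega> ^ 4 * norm \<omega> ^ 3)"
      using n by (simp add: field_simps power_numeral_reduce)
    also have "\<dots> \<le> 34 / ((2 * r) ^ 4 * norm \<omega> ^ 3)"
      using \<omega>' r n by (intro divide_left_mono mult_right_mono power_mono mult_pos_pos) auto
    finally show ?thesis by simp
  qed
  have Q_holo: "Q holomorphic_on ball 0 r"
    unfolding Q_def
  proof (rule normally_convergent_sum_holomorphic[OF open_ball _ bound summable_far])
    fix \<omega> assume \<omega>: "\<omega> \<in> far r"
    show "wp_remainder \<omega> holomorphic_on ball 0 r"
      unfolding wp_remainder_def[abs_def]
      by (intro holomorphic_intros) (use far_diff_nonzero[OF r \<omega>] in auto)
  qed
  have expansion: "P z = 1 / z\<^sup>2 + lattice_g2 \<Lambda> / 20 * z\<^sup>2 + lattice_g3 \<Lambda> / 28 * z ^ 4 + z ^ 5 * Q z"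
    if z: "z \<in> ball 0 r - {0}" for z
  proof -
    define S where "S k = (\<Sum>\<^sub>\<infinity>\<omega>\<in>\<Lambda> - {0}. 1 / \<omega> ^ k)" for k
    have S: "((\<lambda>\<omega>. 1 / \<omega> ^ k) has_sum S k) (\<Lambda> - {0})" if "k \<ge> 3" for k
      unfolding S_def by (intro has_sum_infsum inverse_power_summable[OF r far that])
    have "(\<lambda>\<omega>. wp_remainder \<omega> z) summable_on far r"
      by (rule abs_summable_summable, rule Infinite_Sum.abs_summable_on_comparison_test'[OF summable_far])
         (rule bound, assumption, use z in simp)
    hence R: "((\<lambda>\<omega>. wp_remainder \<omega> z) has_sum Q z) (\<Lambda> - {0})"
      unfolding Q_def far by (rule has_sum_infsum)
    have "((\<lambda>\<omega>. 2 * z * (1 / \<omega> ^ 3) + 3 * z ^ 2 * (1 / \<omega> ^ 4) + 4 * z ^ 3 * (1 / \<omega> ^ 5)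
           + 5 * z ^ 4 * (1 / \<omega> ^ 6) + z ^ 5 * wp_remainder \<omega> z) has_sum
        (2 * z * S 3 + 3 * z ^ 2 * S 4 + 4 * z ^ 3 * S 5 + 5 * z ^ 4 * S 6 + z ^ 5 * Q z)) (\<Lambda> - {0})"
      by (intro has_sum_add has_sum_cmult_right S R) auto
    moreover have "z \<noteq> \<omega>" if "\<omega> \<in> \<Lambda> - {0}" for \<omega>
      using that z far_diff_nonzero(2)[OF r, of \<omega> z] far by auto
    ultimately have "((\<lambda>\<omega>. wp_term \<omega> z) has_sum
        (2 * z * S 3 + 3 * z ^ 2 * S 4 + 4 * z ^ 3 * S 5 + 5 * z ^ 4 * S 6 + z ^ 5 * Q z)) (\<Lambda> - {0})"
      by (subst has_sum_cong[OF wp_term_expansion]) auto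
    moreover have "S 3 = 0" "S 5 = 0" by (simp_all add: S_def odd_inverse_power_sum)
    ultimately have "(\<Sum>\<^sub>\<infinity>\<omega>\<in>\<Lambda> - {0}. wp_term \<omega> z) = 3 * z ^ 2 * S 4 + 5 * z ^ 4 * S 6 + z ^ 5 * Q z"
      by (auto dest: infsumI)
    moreover have "z \<notin> \<Lambda>" using z d(2)[of z] d(1) by (auto simp: r_def)
    moreover have "lattice_g2 \<Lambda> = 60 * S 4" "lattice_g3 \<Lambda> = 140 * S 6"
      by (simp_all add: lattice_g2_def lattice_g3_def S_def)
    ultimately show ?thesis
      by (simp add: weierstrass_p_def wp_term_def)
  qed
  moreover have "deriv P z = - 2 / z ^ 3 + lattice_g2 \<Lambda> / 10 * z + lattice_g3 \<Lambda> / 7 * z ^ 3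
         + (5 * z ^ 4 * Q z + z ^ 5 * deriv Q z)" if z: "z \<in> ball 0 r - {0}" for z
  proof -
    define a where "a = lattice_g2 \<Lambda> / 20"
    define b where "b = lattice_g3 \<Lambda> / 28"
    have "(Q has_field_derivative deriv Q z) (at z)"
      using holomorphic_derivI[OF Q_holo open_ball] z by auto
    hence "((\<lambda>z. 1 / z\<^sup>2 + a * z\<^sup>2 + b * z ^ 4 + z ^ 5 * Q z) has_field_derivative
       (- 2 / z ^ 3 + 2 * a * z + 4 * b * z ^ 3 + (5 * z ^ 4 * Q z + z ^ 5 * deriv Q z))) (at z)"
      using z by (auto intro!: derivative_eq_intros simp: field_simps power_numeral_reduce)
    hence "(P has_field_derivative
       (- 2 / z ^ 3 + 2 * a * z + 4 * b * z ^ 3 + (5 * z ^ 4 * Q z + z ^ 5 * deriv Q z))) (at z)"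
      by (rule has_field_derivative_transform_within_open[of _ _ _ "ball 0 r - {0}"])
         (use z expansion in \<open>auto simp: a_def b_def\<close>)
    from DERIV_imp_deriv[OF this] show ?thesis by (simp add: a_def b_def)
  qed
  ultimately show ?thesis using that r Q_holo expansion by blast
qed

lemma P_analytic: "z \<notin> \<Lambda> \<Longrightarrow> P analytic_on {z}"
  using P_holomorphic open_compl analytic_at by blast

lemma P_meromorphic: "P meromorphic_on UNIV"
proof -
  obtain r Q where r: "r > 0" and Q: "Q holomorphic_on ball 0 r" and
    e: "\<And>z. z \<in> ball 0 r - {0} \<Longrightarrow>
       P z = 1 / z\<^sup>2 + lattice_g2 \<Lambda> / 20 * z\<^sup>2 + lattice_g3 \<Lambda> / 28 * z ^ 4 + z ^ 5 * Q z"
    using P_expansion by metis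
  have "Q analytic_on {0}" using Q r by (metis analytic_at centre_in_ball open_ball)
  hence "(\<lambda>z. 1 / z\<^sup>2 + lattice_g2 \<Lambda> / 20 * z\<^sup>2 + lattice_g3 \<Lambda> / 28 * z ^ 4 + z ^ 5 * Q z) meromorphic_on {0}"
    by (intro meromorphic_intros analytic_on_imp_meromorphic_on[of Q])
  moreover have "eventually (\<lambda>z. z \<in> ball 0 r - {0}) (at 0)"
    using r by (intro eventually_at_in_open) auto
  hence "eventually (\<lambda>z. P z = 1 / z\<^sup>2 + lattice_g2 \<Lambda> / 20 * z\<^sup>2 + lattice_g3 \<Lambda> / 28 * z ^ 4 + z ^ 5 * Q z) (at 0)"
    by eventually_elim (rule e)
  ultimately have 0: "P meromorphic_on {0}"
    by (subst meromorphic_on_cong[OF _ refl]) simp_all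
  have "P meromorphic_on {z}" for z
  proof (cases "z \<in> \<Lambda>")
    case True
    have "(\<lambda>w. P (w - z)) meromorphic_on {z}"
      by (rule meromorphic_on_compose[OF 0]) (auto intro!: analytic_intros)
    moreover have "P (w - z) = P w" for w using P_periodic[of "- z" w] True by simp
    ultimately show ?thesis by simp
  qed (use P_analytic analytic_on_imp_meromorphic_on in auto)
  thus ?thesis using meromorphic_on_meromorphic_at by blast
qed

lemma P_pole:
  assumes "\<omega> \<in> \<Lambda>"
  shows "is_pole P \<omega>"
proof -
  obtain r Q where r: "r > 0" and Q: "Q holomorphic_on ball 0 r" and
    e: "\<And>z. z \<in> ball 0 r - {0} \<Longrightarrow>
       P z = 1 / z\<^sup>2 + lattice_g2 \<Lambda> / 20 * z\<^sup>2 + lattice_g3 \<Lambda> / 28 * z ^ 4 + z ^ 5 * Q z"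
    using P_expansion by metis
  let ?f = "\<lambda>z. 1 + lattice_g2 \<Lambda> / 20 * z ^ 4 + lattice_g3 \<Lambda> / 28 * z ^ 6 + z ^ 7 * Q z"
  have "is_pole (\<lambda>z. ?f z / z\<^sup>2) 0"
    by (rule is_pole_basic'[of _ "ball 0 r"]) (use Q r in \<open>auto intro!: holomorphic_intros\<close>)
  moreover have "eventually (\<lambda>z. z \<in> ball 0 r - {0}) (at 0)"
    using r by (intro eventually_at_in_open) auto
  hence "eventually (\<lambda>z. ?f z / z\<^sup>2 = P z) (at 0)"
    by eventually_elim (auto simp: e field_simps power_numeral_reduce)
  ultimately have "is_pole P 0" by (rule is_pole_transform) simp
  hence "is_pole (\<lambda>z. P (z + \<omega>)) 0" using P_periodic[OF assms] by simp
  thus ?thesis by (simp add: is_pole_shift_0[of P \<omega>] add.commute)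
qed

lemma periods_P: "periods P = \<Lambda>"
proof
  show "\<Lambda> \<subseteq> periods P" by (auto simp: periods_def P_periodic)
  show "periods P \<subseteq> \<Lambda>"
  proof
    fix \<omega> assume "\<omega> \<in> periods P"
    hence "is_pole (\<lambda>z. P (\<omega> + z)) 0"
      using P_pole[of 0] by (simp add: periods_def add.commute)
    hence "is_pole P \<omega>" by (simp add: is_pole_shift_0[of P \<omega>])
    thus "\<omega> \<in> \<Lambda>" using P_analytic analytic_imp_not_pole by blast
  qed
qed

lemma P_nonconst: "eventually (\<lambda>w. P w \<noteq> c) (at z)"
proof -
  have "\<not> eventually (\<lambda>z. P z = c) (cosparse UNIV)"
  proof
    assume "eventually (\<lambda>z. P z = c) (cosparse UNIV)"
    hence "eventually (\<lambda>z. P z = c) (at 0)" by (simp add: eventually_cosparse_imp_eventually_at)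
    hence "is_pole (\<lambda>_. c) (0::complex)" by (rule is_pole_transform[OF P_pole[OF zero_mem] _ refl])
    thus False using analytic_imp_not_pole[OF analytic_on_const] by blast
  qed
  hence "eventually (\<lambda>z. P z \<noteq> c) (cosparse UNIV)"
    using meromorphic_imp_constant_or_avoid[OF P_meromorphic] by auto
  thus ?thesis by (rule eventually_cosparse_imp_eventually_at) simp
qed

lemma deriv_P_shift:
  assumes "\<omega> \<in> \<Lambda>"
  shows "deriv P (z + \<omega>) = deriv P z"
proof -
  have "(\<lambda>x. P (\<omega> + x)) = P" using P_periodic[OF assms] by (simp add: add.commute fun_eq_iff)
  hence "(P has_field_derivative d) (at (z + \<omega>)) \<longleftrightarrow> (P has_field_derivative d) (at z)" for d
    using DERIV_shift[of P d z \<omega>] by (simp add: add.commute)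
  thus ?thesis unfolding deriv_def by simp
qed

text \<open>
  The difference \<open>f\<close> of the two sides is elliptic and holomorphic off the lattice. Multiplying the expansions of
  \<open>\<wp>\<close> and \<open>\<wp>'\<close> by \<open>z\<^sup>2\<close> and \<open>z\<^sup>3\<close> shows that all polar terms of \<open>f\<close> at \<open>0\<close> and its constant term cancel.
  So \<open>f\<close> has no poles, is constant, and its limit at \<open>0\<close> is \<open>0\<close>.
\<close>

theorem P_differential_equation:
  assumes z: "z \<notin> \<Lambda>"
  shows "(deriv P z)\<^sup>2 = 4 * P z ^ 3 - lattice_g2 \<Lambda> * P z - lattice_g3 \<Lambda>"
proof -
  define f where "f w = (deriv P w)\<^sup>2 - 4 * P w ^ 3 + lattice_g2 \<Lambda> * P w + lattice_g3 \<Lambda>" for w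
  obtain r Q where r: "r > 0" and Q: "Q holomorphic_on ball 0 r" and
    e: "\<And>z. z \<in> ball 0 r - {0} \<Longrightarrow>
       P z = 1 / z\<^sup>2 + lattice_g2 \<Lambda> / 20 * z\<^sup>2 + lattice_g3 \<Lambda> / 28 * z ^ 4 + z ^ 5 * Q z" and
    e': "\<And>z. z \<in> ball 0 r - {0} \<Longrightarrow>
       deriv P z = - 2 / z ^ 3 + lattice_g2 \<Lambda> / 10 * z + lattice_g3 \<Lambda> / 7 * z ^ 3
         + (5 * z ^ 4 * Q z + z ^ 5 * deriv Q z)"
    using P_expansion by metis
  define a where "a = lattice_g2 \<Lambda> / 20"
  define b where "b = lattice_g3 \<Lambda> / 28"
  define Q' where "Q' = deriv Q"
  define p where "p w = a + b * w\<^sup>2 + w ^ 3 * Q w" for w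
  define q where "q w = 2 * a + 4 * b * w\<^sup>2 + w ^ 3 * (5 * Q w + w * Q' w)" for w
  define G where "G w = - (32 * Q w + 4 * w * Q' w) +
    w * ((q w)\<^sup>2 - 12 * (p w)\<^sup>2 - 4 * w ^ 4 * p w ^ 3 + 20 * a * p w)" for w
  \<comment> \<open>Here \<open>\<wp> = (1 + w ^ 4 * p) / w\<^sup>2\<close> and \<open>\<wp>' = (-2 + w ^ 4 * q) / w\<^sup>3\<close>; the coefficients \<open>1/20\<close> and \<open>1/28\<close> make the terms of order \<open>-2\<close> and \<open>0\<close> cancel.\<close>
  have f0: "f w = w * G w" if w: "w \<in> ball 0 r - {0}" for w
  proof -
    have dP: "deriv P w = - 2 / w ^ 3 + 2 * a * w + 4 * b * w ^ 3 + (5 * w ^ 4 * Q w + w ^ 5 * Q' w)"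
      using e'[OF w] by (simp add: a_def b_def Q'_def)
    have w0: "w \<noteq> 0" using w by auto
    have 1: "w ^ 3 * deriv P w = - 2 + w ^ 4 * q w"
      using w0 unfolding dP q_def by (simp add: algebra_simps power_numeral_reduce)
    have 2: "w\<^sup>2 * P w = 1 + w ^ 4 * p w"
      using w0 unfolding e[OF w] p_def a_def b_def by (simp add: algebra_simps power_numeral_reduce)
    have "w ^ 6 * f w = (w ^ 3 * deriv P w)\<^sup>2 - 4 * (w\<^sup>2 * P w) ^ 3 + 20 * a * w ^ 4 * (w\<^sup>2 * P w) + 28 * b * w ^ 6"
      unfolding f_def a_def b_def by (simp add: algebra_simps power_numeral_reduce)
    also have "\<dots> = w ^ 6 * (w * G w)"
      unfolding 1 2 G_def p_def q_def by algebra
    finally show ?thesis using w0 by simp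
  qed
  have "f \<midarrow>0\<rightarrow> 0 * G 0"
  proof (rule Lim_transform_eventually)
    have "Q' holomorphic_on ball 0 r" unfolding Q'_def using Q by (intro holomorphic_deriv) auto
    hence "(\<lambda>w. w * G w) holomorphic_on ball 0 r"
      unfolding G_def p_def q_def using Q by (intro holomorphic_intros)
    hence "isCont (\<lambda>w. w * G w) 0"
      using r by (intro analytic_at_imp_isCont) (auto simp: analytic_at intro!: exI[of _ "ball 0 r"])
    thus "(\<lambda>w. w * G w) \<midarrow>0\<rightarrow> 0 * G 0" by (simp add: isCont_def)
    have "eventually (\<lambda>z. z \<in> ball 0 r - {0}) (at 0)"
      using r by (intro eventually_at_in_open) auto
    thus "eventually (\<lambda>w. w * G w = f w) (at 0)" by eventually_elim (simp add: f0)
  qed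
  hence lim0: "f \<midarrow>0\<rightarrow> 0" by simp
  have mero: "f meromorphic_on UNIV"
    unfolding f_def by (intro meromorphic_intros P_meromorphic meromorphic_on_deriv)
  have per: "f (w + \<omega>) = f w" if "\<omega> \<in> \<Lambda>" for w \<omega>
    by (simp add: f_def deriv_P_shift P_periodic that)
  have an: "f analytic_on {w}" if "w \<notin> \<Lambda>" for w
    unfolding f_def by (intro analytic_intros analytic_deriv P_analytic that)
  have "\<not> is_pole f w" for w
  proof (cases "w \<in> \<Lambda>")
    case True
    have "\<not> is_pole f 0"
      using lim0 by (metis at_neq_bot is_pole_def not_tendsto_and_filterlim_at_infinity)
    moreover have "(\<lambda>x. f (w + x)) = f" using per[OF True] by (simp add: add.commute fun_eq_iff)
    ultimately show ?thesis by (simp add: is_pole_shift_0[of f w])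
  qed (use an analytic_imp_not_pole in blast)
  then obtain c where c: "\<And>w. remove_sings f w = c"
    using elliptic_without_poles_const[OF mero per] by blast
  have "c = 0" using c[of 0] remove_sings_eqI[OF lim0] by simp
  hence "f z = 0" using c[of z] an[OF z] by simp
  thus ?thesis by (simp add: f_def algebra_simps)
qed


text \<open>
  These limits give the sign of \<open>\<wp>\<close> near \<open>0\<close> on the real line, and the derivative at \<open>0\<close> of quotients
  such as \<open>(\<wp> - 1/6) / \<wp>'\<close>.
\<close>

lemma P_asymptotics:
  shows "((\<lambda>z. z\<^sup>2 * P z) \<longlongrightarrow> 1) (at 0)" "((\<lambda>z. z ^ 3 * deriv P z) \<longlongrightarrow> - 2) (at 0)"
proof -
  obtain r Q where r: "r > 0" and Q: "Q holomorphic_on ball 0 r" and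
    e: "\<And>z. z \<in> ball 0 r - {0} \<Longrightarrow>
       P z = 1 / z\<^sup>2 + lattice_g2 \<Lambda> / 20 * z\<^sup>2 + lattice_g3 \<Lambda> / 28 * z ^ 4 + z ^ 5 * Q z" and
    e': "\<And>z. z \<in> ball 0 r - {0} \<Longrightarrow>
       deriv P z = - 2 / z ^ 3 + lattice_g2 \<Lambda> / 10 * z + lattice_g3 \<Lambda> / 7 * z ^ 3
         + (5 * z ^ 4 * Q z + z ^ 5 * deriv Q z)"
    using P_expansion by metis
  have ev: "eventually (\<lambda>z. z \<in> ball 0 r - {0}) (at (0::complex))"
    using r by (intro eventually_at_in_open) auto
  have Q': "deriv Q holomorphic_on ball 0 r" using Q by (intro holomorphic_deriv) auto
  have cont: "f \<midarrow>0\<rightarrow> f 0" if "f holomorphic_on ball 0 r" for f :: "complex \<Rightarrow> complex"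
  proof -
    have "f analytic_on {0}" using that r by (metis analytic_at centre_in_ball open_ball)
    thus ?thesis using analytic_at_imp_isCont isCont_def by blast
  qed
  let ?f = "\<lambda>z. 1 + lattice_g2 \<Lambda> / 20 * z ^ 4 + lattice_g3 \<Lambda> / 28 * z ^ 6 + z ^ 7 * Q z"
  have "?f \<midarrow>0\<rightarrow> ?f 0" by (intro cont holomorphic_intros Q)
  moreover have "eventually (\<lambda>z. ?f z = z\<^sup>2 * P z) (at 0)"
    using ev by eventually_elim (simp add: e field_simps power_numeral_reduce)
  ultimately show "((\<lambda>z. z\<^sup>2 * P z) \<longlongrightarrow> 1) (at 0)"
    using Lim_transform_eventually by fastforce
  let ?h = "\<lambda>z. - 2 + lattice_g2 \<Lambda> / 10 * z ^ 4 + lattice_g3 \<Lambda> / 7 * z ^ 6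
    + (5 * z ^ 7 * Q z + z ^ 8 * deriv Q z)"
  have "?h \<midarrow>0\<rightarrow> ?h 0" by (intro cont holomorphic_intros Q Q')
  moreover have "eventually (\<lambda>z. ?h z = z ^ 3 * deriv P z) (at 0)"
    using ev by eventually_elim (simp add: e' field_simps power_numeral_reduce)
  ultimately show "((\<lambda>z. z ^ 3 * deriv P z) \<longlongrightarrow> - 2) (at 0)"
    using Lim_transform_eventually by fastforce
qed

lemma deriv_P_has_derivative:
  assumes z: "z \<notin> \<Lambda>" and nz: "deriv P z \<noteq> 0"
  shows "(deriv P has_field_derivative 6 * (P z)\<^sup>2 - lattice_g2 \<Lambda> / 2) (at z)"
proof -
  have 1: "(P has_field_derivative deriv P z) (at z)"
    using P_field_differentiable[OF z] field_differentiable_derivI by auto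
  have "deriv P holomorphic_on - \<Lambda>"
    by (rule holomorphic_deriv[OF P_holomorphic open_compl])
  then obtain d where 2: "(deriv P has_field_derivative d) (at z)"
    using holomorphic_derivI[OF _ open_compl, of "deriv P" z] z by auto
  have "((\<lambda>w. (deriv P w)\<^sup>2) has_field_derivative 2 * deriv P z * d) (at z)"
    by (rule derivative_eq_intros 2 refl | simp)+
  moreover have "((\<lambda>w. (deriv P w)\<^sup>2) has_field_derivative
      12 * (P z)\<^sup>2 * deriv P z - lattice_g2 \<Lambda> * deriv P z) (at z)"
  proof (rule has_field_derivative_transform_within_open[OF _ open_compl])
    show "((\<lambda>w. 4 * P w ^ 3 - lattice_g2 \<Lambda> * P w - lattice_g3 \<Lambda>) has_field_derivative
        12 * (P z)\<^sup>2 * deriv P z - lattice_g2 \<Lambda> * deriv P z) (at z)"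
      by (rule derivative_eq_intros 1 refl | simp)+
  qed (use z P_differential_equation in auto)
  ultimately have "2 * deriv P z * d = 12 * (P z)\<^sup>2 * deriv P z - lattice_g2 \<Lambda> * deriv P z"
    by (rule DERIV_unique)
  also have "\<dots> = 2 * deriv P z * (6 * (P z)\<^sup>2 - lattice_g2 \<Lambda> / 2)"
    by (simp add: algebra_simps)
  finally have "d = 6 * (P z)\<^sup>2 - lattice_g2 \<Lambda> / 2" using nz by simp
  thus ?thesis using 2 by simp
qed

end


section \<open>Half-periods\<close>

context complex_lattice
begin

lemma P_meromorphic_at: "P meromorphic_on {z}" "deriv P meromorphic_on {z}"
proof -
  show "P meromorphic_on {z}" by (rule meromorphic_on_subset[OF P_meromorphic]) simp
  thus "deriv P meromorphic_on {z}" by (rule meromorphic_on_deriv)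
qed

lemma deriv_P_minus:
  assumes "z \<notin> \<Lambda>"
  shows "deriv P (- z) = - deriv P z"
proof -
  have "(P has_field_derivative deriv P (- z)) (at (- z))"
    using P_field_differentiable[of "- z"] assms field_differentiable_derivI by auto
  hence "((\<lambda>w. P (- w)) has_field_derivative deriv P (- z) * (- 1)) (at z)"
    by (rule DERIV_chain2) (auto intro!: derivative_eq_intros)
  hence "(P has_field_derivative - deriv P (- z)) (at z)" by (simp add: P_minus)
  from DERIV_imp_deriv[OF this] show ?thesis by simp
qed

lemma deriv_P_half_period:
  assumes "2 * w \<in> \<Lambda>" "w \<notin> \<Lambda>"
  shows "deriv P w = 0"
proof -
  have "deriv P w = deriv P (- w)" using deriv_P_shift[OF assms(1), of "- w"] by simp
  also have "\<dots> = - deriv P w" using deriv_P_minus assms(2) by simp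
  finally have "2 * deriv P w = 0" by simp
  thus ?thesis by simp
qed

lemma zorder_P_diff_0: "zorder (\<lambda>z. P z - c) 0 = - 2"
proof -
  obtain r Q where r: "r > 0" and Q: "Q holomorphic_on ball 0 r" and
    e: "\<And>z. z \<in> ball 0 r - {0} \<Longrightarrow>
       P z = 1 / z\<^sup>2 + lattice_g2 \<Lambda> / 20 * z\<^sup>2 + lattice_g3 \<Lambda> / 28 * z ^ 4 + z ^ 5 * Q z"
    using P_expansion by metis
  let ?f = "\<lambda>z. 1 - c * z\<^sup>2 + lattice_g2 \<Lambda> / 20 * z ^ 4 + lattice_g3 \<Lambda> / 28 * z ^ 6 + z ^ 7 * Q z"
  show ?thesis
  proof (rule zorder_eqI[of "ball 0 r" 0 ?f])
    fix w :: complex assume "w \<in> ball 0 r" "w \<noteq> 0"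
    thus "P w - c = ?f w * (w - 0) powi - 2"
      by (simp add: e power_int_minus field_simps power_numeral_reduce)
  qed (use Q r in \<open>auto intro!: holomorphic_intros\<close>)
qed

text \<open>
  Zeros of \<open>\<wp>'\<close> are points where \<open>\<wp>\<close> takes one of the finitely many roots of the cubic.
\<close>

lemma eventually_deriv_P_nonzero: "eventually (\<lambda>w. deriv P w \<noteq> 0) (at z)"
proof -
  define p where "p = [:- lattice_g3 \<Lambda>, - lattice_g2 \<Lambda>, 0, 4:]"
  have "finite {x. poly p x = 0}" by (rule poly_roots_finite) (simp add: p_def)
  moreover have "eventually (\<lambda>w. \<forall>x\<in>{x. poly p x = 0}. P w \<noteq> x) (at z)"
    by (intro eventually_ball_finite calculation ballI P_nonconst)
  hence "eventually (\<lambda>w. poly p (P w) \<noteq> 0) (at z)" by eventually_elim auto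
  thus ?thesis
    using eventually_not_mem[of z]
  proof eventually_elim
    case (elim w)
    have "(deriv P w)\<^sup>2 = poly p (P w)"
      using P_differential_equation[OF elim(2)]
      by (simp add: p_def algebra_simps power_numeral_reduce)
    thus ?case using elim(1) by auto
  qed
qed

lemma zorder_deriv_P:
  assumes "zorder (\<lambda>z. P z - c) w \<noteq> 0"
  shows "zorder (deriv P) w = zorder (\<lambda>z. P z - c) w - 1"
proof -
  have m: "(\<lambda>z. P z - c) meromorphic_on {w}"
    by (intro meromorphic_intros P_meromorphic_at)
  have "zorder (deriv (\<lambda>z. P z - c)) w = zorder (\<lambda>z. P z - c) w - 1"
  proof (rule zorder_deriv_minus_1)
    show "\<exists>\<^sub>F z in at w. P z - c \<noteq> 0"
      using P_nonconst[of c w] by (simp add: eventually_frequently)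
  qed (use m assms meromorphic_on_isolated_singularity meromorphic_on_not_essential in auto)
  moreover have "zorder (deriv (\<lambda>z. P z - c)) w = zorder (deriv P) w"
  proof (rule zorder_cong)
    show "eventually (\<lambda>z. deriv (\<lambda>z. P z - c) z = deriv P z) (at w)"
      using eventually_not_mem[of w]
    proof eventually_elim
      case (elim z)
      thus ?case using P_field_differentiable[of z] by (simp add: deriv_diff)
    qed
  qed simp
  ultimately show ?thesis by simp
qed

lemma zorder_P_half_period:
  assumes "2 * w \<in> \<Lambda>" "w \<notin> \<Lambda>"
  shows "zorder (\<lambda>z. P z - P w) w \<ge> 2"
proof -
  have freq: "\<exists>\<^sub>F z in at w. P z - P w \<noteq> 0" "\<exists>\<^sub>F z in at w. deriv P z \<noteq> 0"
    using P_nonconst[of "P w" w] eventually_deriv_P_nonzero[of w] by (simp_all add: eventually_frequently)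
  have an: "(\<lambda>z. P z - P w) analytic_on {w}" "deriv P analytic_on {w}"
    using P_analytic[OF assms(2)] by (auto intro!: analytic_intros analytic_deriv)
  have "zorder (\<lambda>z. P z - P w) w > 0"
    using zorder_pos_iff'[OF an(1) freq(1)] by simp
  moreover have "zorder (deriv P) w > 0"
    using zorder_pos_iff'[OF an(2) freq(2)] deriv_P_half_period[OF assms] by simp
  ultimately show ?thesis using zorder_deriv_P[of "P w" w] by simp
qed

text \<open>
  Consider \<open>q(u) = (\<wp>(u) - \<wp>(w)) (\<wp>(u + w) - \<wp>(w))\<close>. It is periodic under the lattice and, as \<open>2 w\<close> is a period of \<open>\<wp>\<close>,
  also under \<open>w\<close>. At \<open>0\<close> the double pole of the first factor is cancelled by the double zero of the second, so \<open>q\<close>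
  has no poles and is constant. Any further zero of \<open>\<wp> - \<wp>(w)\<close> would make this constant \<open>0\<close>, although neither factor
  vanishes identically.
\<close>

lemma P_eq_half_period_value_imp:
  assumes w: "2 * w \<in> \<Lambda>" "w \<notin> \<Lambda>" and z: "z \<notin> \<Lambda>" "P z = P w"
  shows "z - w \<in> \<Lambda>"
proof (rule ccontr)
  assume zw: "z - w \<notin> \<Lambda>"
  define q where "q u = (P u - P w) * (P (u + w) - P w)" for u
  have sh: "P (u + w + w) = P u" for u
    using P_periodic[OF w(1), of u] by (simp add: algebra_simps)
  have ww: "P (u - w) = P (u + w)" for u
    using sh[of "u - w"] by simp
  have mero_shift: "(\<lambda>u. P (u + w)) meromorphic_on UNIV"
    by (rule meromorphic_on_compose[OF P_meromorphic]) (auto intro!: analytic_intros)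
  have mero: "q meromorphic_on UNIV"
    unfolding q_def by (intro meromorphic_intros P_meromorphic mero_shift)
  have mero': "q meromorphic_on {u}" for u using mero meromorphic_on_subset by blast
  have per: "q (u + \<omega>) = q u" if "\<omega> \<in> \<Lambda>" for u \<omega>
    using P_periodic[OF that, of u] P_periodic[OF that, of "u + w"]
    by (simp add: q_def algebra_simps)
  \<comment> \<open>translation by \<open>w\<close> exchanges the two factors\<close>
  have per_w: "q (u + w) = q u" for u
    using sh[of u] by (simp add: q_def mult.commute)
  have an: "q analytic_on {u}" if "u \<notin> \<Lambda>" "u - w \<notin> \<Lambda>" for u
  proof -
    have "P analytic_on {u + w}"
      using P_analytic[of "u + w"] that add_mem_iff[OF w(1), of "u - w"] by (simp add: algebra_simps)
    hence "(\<lambda>u. P (u + w)) analytic_on {u}"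
      by (intro analytic_on_compose[of "\<lambda>u. u + w" "{u}" P, unfolded o_def])
         (auto intro!: analytic_on_add analytic_on_ident analytic_on_const)
    thus ?thesis unfolding q_def using P_analytic[OF that(1)] by (intro analytic_intros) auto
  qed
  have ev: "eventually (\<lambda>u. P (u + w) - P w \<noteq> 0) (at 0)"
    using P_nonconst[of "P w" w] by (simp add: at_to_0[of w] eventually_filtermap)
  have ev0: "eventually (\<lambda>u. P u - P w \<noteq> 0) (at 0)"
    using P_nonconst[of "P w" 0] by simp
  have no_pole_0: "\<not> is_pole q 0"
  proof
    assume "is_pole q 0"
    hence "zorder q 0 < 0"
      by (intro isolated_pole_imp_neg_zorder meromorphic_on_isolated_singularity mero')
    moreover have "zorder q 0 = zorder (\<lambda>u. P u - P w) 0 + zorder (\<lambda>u. P (u + w) - P w) 0"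
      unfolding q_def
    proof (rule zorder_mult)
      show "(\<lambda>u. P u - P w) meromorphic_on {0}" by (intro meromorphic_intros P_meromorphic_at)
      show "(\<lambda>u. P (u + w) - P w) meromorphic_on {0}"
        by (rule meromorphic_on_subset[of _ UNIV]) (intro meromorphic_intros mero_shift, simp)
    qed (use ev ev0 in \<open>simp_all add: eventually_frequently\<close>)
    moreover have "zorder (\<lambda>u. P (u + w) - P w) 0 = zorder (\<lambda>z. P z - P w) w"
      by (rule zorder_shift[symmetric])
    ultimately show False
      using zorder_P_half_period[OF w] zorder_P_diff_0[of "P w"] by simp
  qed
  have shift_pole: "is_pole q (u + v) \<longleftrightarrow> is_pole q v" if "\<And>x. q (x + u) = q x" for u v
    using is_pole_shift_iff[of q u v] that by (simp add: o_def add.commute)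
  have "\<not> is_pole q u" if "u \<in> \<Lambda> \<or> u - w \<in> \<Lambda>" for u
  proof (cases "u \<in> \<Lambda>")
    case True
    thus ?thesis using shift_pole[of u 0] no_pole_0 per[OF True] by simp
  next
    case False
    hence "q (x + u) = q x" for x
    proof -
      have "q (x + u) = q ((x + w) + (u - w))" by (simp add: algebra_simps)
      also have "\<dots> = q x" using False that per[of "u - w" "x + w"] per_w[of x] by simp
      finally show ?thesis .
    qed
    thus ?thesis using shift_pole[of u 0] no_pole_0 by simp
  qed
  hence "\<not> is_pole q u" for u
    using an analytic_imp_not_pole by blast
  then obtain c where c: "\<And>u. remove_sings q u = c"
    using elliptic_without_poles_const[OF mero per] by blast
  have "q z = 0" by (simp add: q_def z)
  hence "c = 0" using c[of z] an[OF z(1) zw] by simp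
  hence "eventually (\<lambda>u. q u = 0) (at 0)"
    using eventually_remove_sings_eq_at[OF meromorphic_on_isolated_singularity[OF mero'], of 0] c
    by simp
  with ev ev0 have "eventually (\<lambda>_. False) (at (0::complex))"
    by eventually_elim (simp add: q_def)
  thus False by simp
qed

lemma P_cnj:
  assumes "cnj ` \<Lambda> \<subseteq> \<Lambda>"
  shows "P (cnj z) = cnj (P z)"
proof -
  have mem: "cnj \<omega> \<in> \<Lambda> \<longleftrightarrow> \<omega> \<in> \<Lambda>" for \<omega>
    using assms by (metis complex_cnj_cnj image_subset_iff)
  show ?thesis
  proof (cases "z \<in> \<Lambda>")
    case False
    have "(\<Sum>\<^sub>\<infinity>\<omega>\<in>\<Lambda>. wp_term \<omega> (cnj z)) = (\<Sum>\<^sub>\<infinity>\<omega>\<in>\<Lambda>. cnj (wp_term \<omega> z))"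
      by (rule infsum_reindex_bij_witness[of _ cnj cnj]) (auto simp: mem wp_term_def)
    thus ?thesis using False by (simp add: P_eq_infsum mem)
  qed (simp add: weierstrass_p_def mem)
qed

lemma P_real:
  assumes "cnj ` \<Lambda> \<subseteq> \<Lambda>" "z \<in> \<real>" "z \<notin> \<Lambda>"
  shows "P z \<in> \<real>" "deriv P z \<in> \<real>"
proof -
  have mem: "cnj \<omega> \<in> \<Lambda> \<longleftrightarrow> \<omega> \<in> \<Lambda>" for \<omega>
    using assms(1) by (metis complex_cnj_cnj image_subset_iff)
  have z: "cnj z = z" using assms(2) by (simp add: Reals_cnj_iff)
  show "P z \<in> \<real>" using P_cnj[OF assms(1), of z] by (simp add: z Reals_cnj_iff)
  have "((\<lambda>\<omega>. cnj (- 2 / (z - \<omega>) ^ 3)) has_sum cnj (deriv P z)) \<Lambda>"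
    using deriv_P_has_sum[OF assms(3)] by (simp only: has_sum_cnj_iff)
  hence "((\<lambda>\<omega>. - 2 / (z - \<omega>) ^ 3) has_sum cnj (deriv P z)) \<Lambda>"
    by (rule has_sum_reindex_bij_witness[where i = cnj and j = cnj, THEN iffD1, rotated -1])
       (auto simp: mem z)
  hence "cnj (deriv P z) = deriv P z"
    using deriv_P_has_sum[OF assms(3)] has_sum_unique by blast
  thus "deriv P z \<in> \<real>" by (simp add: Reals_cnj_iff)
qed

end

section \<open>The function \<open>rn\<^sub>2\<close> in terms of \<open>\<wp>\<close>\<close>

locale rn_lattice = complex_lattice +
  fixes k :: real
  assumes k_pos: "0 < k" and k_less_1: "k < 1"
    and g2_eq: "lattice_g2 \<Lambda> = of_real (1/12 * (1 + 3 * k\<^sup>2))"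
    and g3_eq: "lattice_g3 \<Lambda> = of_real (1/216 * (1 - 9 * k\<^sup>2))"
begin

definition rn_wp :: "complex \<Rightarrow> complex" where
  "rn_wp z = - of_real k * ((P z - 1 / 6) / deriv P z)"

lemma deriv_P_squared:
  assumes "z \<notin> \<Lambda>"
  shows "(deriv P z)\<^sup>2 = 4 * (P z - 1 / 6) * ((P z + 1 / 12)\<^sup>2 - (of_real k)\<^sup>2 / 16)"
  unfolding P_differential_equation[OF assms] g2_eq g3_eq
  by (simp add: field_simps power2_eq_square power3_eq_cube)

text \<open>
  At a half-period \<open>\<wp>'\<close> vanishes, so \<open>\<wp>\<close> takes a root of the cubic there.
\<close>

lemma half_period_value:
  assumes "2 * w \<in> \<Lambda>" "w \<notin> \<Lambda>"
  shows "P w = 1 / 6 \<or> P w = of_real (- 1 / 12 + k / 4) \<or> P w = of_real (- 1 / 12 - k / 4)"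
proof -
  have "(P w - 1 / 6) * ((P w + 1 / 12)\<^sup>2 - (of_real k)\<^sup>2 / 16) = 0"
  proof -
    have "4 * (P w - 1 / 6) * ((P w + 1 / 12)\<^sup>2 - (of_real k)\<^sup>2 / 16) = 0"
      using deriv_P_squared[OF assms(2)] unfolding deriv_P_half_period[OF assms] by (metis zero_power2)
    moreover have "a * b = 0" if "4 * a * b = 0" for a b :: complex using that by simp
    ultimately show ?thesis by blast
  qed
  also have "(P w + 1 / 12)\<^sup>2 - (of_real k)\<^sup>2 / 16 =
      (P w - of_real (- 1 / 12 + k / 4)) * (P w - of_real (- 1 / 12 - k / 4))"
    by (simp add: field_simps power2_eq_square)
  finally show ?thesis by simp
qed

text \<open>
  Let \<open>n\<close> be the order of \<open>\<wp> - \<wp>(w)\<close> at \<open>w\<close>, so that \<open>\<wp>'\<close> has order \<open>n - 1\<close>. The roots of the cubic are distinct, so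
  \<open>\<wp>'\<^sup>2\<close> is \<open>\<wp> - \<wp>(w)\<close> times a factor \<open>s\<close> that does not vanish at \<open>w\<close>. Comparing orders gives \<open>2 (n - 1) = n\<close>.
\<close>

lemma zorder_half_period:
  assumes "2 * w \<in> \<Lambda>" "w \<notin> \<Lambda>"
  shows "zorder (\<lambda>z. P z - P w) w = 2" "zorder (deriv P) w = 1"
proof -
  define c where "c = P w"
  define n where "n = zorder (\<lambda>z. P z - c) w"
  define s where "s x = 4 * x\<^sup>2 + 4 * c * x + 4 * c\<^sup>2 - lattice_g2 \<Lambda>" for x
  have "s c \<noteq> 0"
  proof -
    \<comment> \<open>the derivative of the cubic, which is nonzero at each of the three distinct roots\<close>
    define t where "t x = 12 * x\<^sup>2 - lattice_g2 \<Lambda>" for x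
    have "t (1 / 6) = of_real ((1 - k\<^sup>2) / 4)"
      "t (of_real (- 1 / 12 + k / 4)) = of_real (k * (k - 1) / 2)"
      "t (of_real (- 1 / 12 - k / 4)) = of_real (k * (k + 1) / 2)"
      by (simp_all add: t_def g2_eq field_simps power2_eq_square)
    moreover have "s c = t c" by (simp add: s_def t_def power2_eq_square)
    ultimately have "s c = of_real ((1 - k\<^sup>2) / 4) \<or> s c = of_real (k * (k - 1) / 2)
        \<or> s c = of_real (k * (k + 1) / 2)"
      using half_period_value[OF assms] unfolding c_def by metis
    moreover have "(1 - k\<^sup>2) / 4 \<noteq> 0" "k * (k - 1) / 2 \<noteq> 0" "k * (k + 1) / 2 \<noteq> 0"
      using k_pos k_less_1 power_strict_mono[of k 1 2] by auto
    ultimately show ?thesis by (metis of_real_eq_0_iff)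
  qed
  have n: "n \<ge> 2" using zorder_P_half_period[OF assms] by (simp add: n_def c_def)
  hence d: "zorder (deriv P) w = n - 1" using zorder_deriv_P[of c w] by (simp add: n_def)
  have an: "(\<lambda>z. s (P z)) analytic_on {w}"
    unfolding s_def by (intro analytic_intros P_analytic assms)
  have "2 * (n - 1) = zorder (\<lambda>z. (deriv P z)\<^sup>2) w"
    using zorder_power[of "deriv P" w 2] eventually_deriv_P_nonzero[of w]
    by (simp add: P_meromorphic_at eventually_frequently d)
  also have "\<dots> = zorder (\<lambda>z. (P z - c) * s (P z)) w"
  proof (rule zorder_cong)
    have "4 * c ^ 3 - lattice_g2 \<Lambda> * c - lattice_g3 \<Lambda> = 0"
      using P_differential_equation[OF assms(2)] deriv_P_half_period[OF assms] by (simp add: c_def)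
    hence eq: "4 * x ^ 3 - lattice_g2 \<Lambda> * x - lattice_g3 \<Lambda> = (x - c) * s x" for x
      unfolding s_def by algebra
    show "eventually (\<lambda>z. (deriv P z)\<^sup>2 = (P z - c) * s (P z)) (at w)"
      using eventually_not_mem[of w] by eventually_elim (simp add: P_differential_equation eq)
  qed simp
  also have "\<dots> = n + zorder (\<lambda>z. s (P z)) w"
    unfolding n_def
  proof (rule zorder_mult)
    show "(\<lambda>z. P z - c) meromorphic_on {w}" by (intro meromorphic_intros P_meromorphic_at)
    show "(\<lambda>z. s (P z)) meromorphic_on {w}" using an by (rule analytic_on_imp_meromorphic_on)
    show "\<exists>\<^sub>F z in at w. P z - c \<noteq> 0" using P_nonconst[of c w] by (simp add: eventually_frequently)
    have "eventually (\<lambda>z. s (P z) \<noteq> 0) (at w)"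
      using analytic_at_imp_isCont[OF an] \<open>s c \<noteq> 0\<close>
      by (intro tendsto_imp_eventually_ne[of _ "s c"]) (simp_all add: isCont_def c_def)
    thus "\<exists>\<^sub>F z in at w. s (P z) \<noteq> 0" by (simp add: eventually_frequently)
  qed
  also have "zorder (\<lambda>z. s (P z)) w = 0"
    using an \<open>s c \<noteq> 0\<close> by (intro zorder_eq_0I) (simp_all add: c_def)
  finally have "n = 2" by simp
  thus "zorder (\<lambda>z. P z - P w) w = 2" "zorder (deriv P) w = 1"
    using d by (simp_all add: n_def c_def)
qed

lemma rn_wp_meromorphic: "rn_wp meromorphic_on UNIV"
  unfolding rn_wp_def[abs_def] by (intro meromorphic_intros P_meromorphic meromorphic_on_deriv)

lemma eventually_rn_wp_nonzero: "eventually (\<lambda>w. rn_wp w \<noteq> 0) (at z)"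
  using P_nonconst[of "1/6" z] eventually_deriv_P_nonzero[of z]
  by eventually_elim (use k_pos in \<open>simp add: rn_wp_def\<close>)

lemma zorder_rn_wp: "zorder rn_wp z = zorder (\<lambda>w. P w - 1 / 6) z - zorder (deriv P) z"
proof -
  have "zorder rn_wp z = zorder (\<lambda>w. (P w - 1 / 6) / deriv P w) z"
    unfolding rn_wp_def[abs_def] using k_pos by (intro zorder_cmult) simp
  also have "\<dots> = zorder (\<lambda>w. P w - 1 / 6) z - zorder (deriv P) z"
  proof (rule zorder_divide)
    show "(\<lambda>w. P w - 1 / 6) meromorphic_on {z}" "deriv P meromorphic_on {z}"
      by (intro meromorphic_intros P_meromorphic_at)+
    show "\<exists>\<^sub>F w in at z. P w - 1 / 6 \<noteq> 0" "\<exists>\<^sub>F w in at z. deriv P w \<noteq> 0"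
      using P_nonconst[of "1/6" z] eventually_deriv_P_nonzero[of z]
      by (simp_all add: eventually_frequently)
  qed
  finally show ?thesis .
qed

lemma zorder_rn_wp_0: "zorder rn_wp 0 = 1"
  using zorder_rn_wp[of 0] zorder_P_diff_0[of "1/6"] zorder_deriv_P[of "1/6" 0] by simp

lemma zorder_rn_wp_half_period:
  assumes "2 * w \<in> \<Lambda>" "w \<notin> \<Lambda>"
  shows "zorder rn_wp w = (if P w = 1 / 6 then 1 else - 1)"
proof (cases "P w = 1 / 6")
  case True
  thus ?thesis using zorder_rn_wp[of w] zorder_half_period[OF assms] unfolding True by simp
next
  case False
  have "zorder (\<lambda>z. P z - 1 / 6) w = 0"
    using False by (intro zorder_eq_0I analytic_intros P_analytic assms) simp
  thus ?thesis using zorder_rn_wp[of w] zorder_half_period(2)[OF assms] False by simp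
qed

lemma rn_wp_simple_zero_or_pole:
  shows "zorder rn_wp z = 1 \<Longrightarrow> simple_zero rn_wp z" "zorder rn_wp z = - 1 \<Longrightarrow> simple_pole rn_wp z"
proof -
  have "rn_wp meromorphic_on {z}" using rn_wp_meromorphic meromorphic_on_subset by blast
  note * = this eventually_rn_wp_nonzero[of z]
  show "zorder rn_wp z = 1 \<Longrightarrow> simple_zero rn_wp z"
    using zorder_pos_imp_isolated_zero[OF *] by (simp add: simple_zero_def)
  show "zorder rn_wp z = - 1 \<Longrightarrow> simple_pole rn_wp z"
    using zorder_neg_imp_is_pole[OF *] by (simp add: simple_pole_def)
qed

text \<open>
  With \<open>\<wp>'' = 6 \<wp>\<^sup>2 - G\<^sub>2 / 2\<close> and the factorised cubic, both sides become rational functions of \<open>\<wp>\<close> alone, and the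
  claim is a polynomial identity.
\<close>

lemma rn_wp_has_derivative:
  assumes z: "z \<notin> \<Lambda>" and nz: "deriv P z \<noteq> 0"
  obtains d where "(rn_wp has_field_derivative d) (at z)" "d\<^sup>2 = rn_wp z ^ 4 - (rn_wp z)\<^sup>2 + (of_real k)\<^sup>2 / 4"
proof -
  define x where "x = P z"
  define y where "y = deriv P z"
  define K where "K = complex_of_real k"
  define p where "p = x - 1 / 6"
  define q where "q = (x + 1 / 12)\<^sup>2 - K\<^sup>2 / 16"
  define D where "D = 6 * x\<^sup>2 - (1 + 3 * K\<^sup>2) / 24"
  define d where "d = - K * ((y * y - p * D) / (y * y))"
  have y: "y \<noteq> 0" using nz by (simp add: y_def)
  have y2: "y\<^sup>2 = 4 * p * q" using deriv_P_squared[OF z] by (simp add: x_def y_def p_def q_def K_def)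
  have 1: "(P has_field_derivative y) (at z)"
    unfolding y_def using P_field_differentiable[OF z] field_differentiable_derivI by auto
  have 2: "(deriv P has_field_derivative D) (at z)"
    using deriv_P_has_derivative[OF z nz] by (simp add: D_def x_def K_def g2_eq field_simps)
  have "(rn_wp has_field_derivative d) (at z)"
    unfolding rn_wp_def[abs_def] d_def K_def
    by (intro DERIV_cmult, rule DERIV_divide[THEN DERIV_cong])
       (use 1 2 nz in \<open>auto intro!: derivative_eq_intros simp: p_def x_def y_def\<close>)
  moreover have "d\<^sup>2 = rn_wp z ^ 4 - (rn_wp z)\<^sup>2 + K\<^sup>2 / 4"
  proof -
    have rn_wp_z: "rn_wp z = - K * (p / y)" by (simp add: rn_wp_def K_def p_def x_def y_def)
    have "(4 * q - D)\<^sup>2 = K\<^sup>2 * p\<^sup>2 - 4 * p * q + 4 * q\<^sup>2"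
      unfolding q_def D_def p_def by (simp add: field_simps power2_eq_square)
    hence "K\<^sup>2 * (p\<^sup>2 * (4 * q - D)\<^sup>2) = K\<^sup>2 * (p\<^sup>2 * (K\<^sup>2 * p\<^sup>2 - 4 * p * q + 4 * q\<^sup>2))" by simp
    hence "K\<^sup>2 * (y\<^sup>2 - p * D)\<^sup>2 = K ^ 4 * p ^ 4 - K\<^sup>2 * p\<^sup>2 * y\<^sup>2 + K\<^sup>2 * (y\<^sup>2)\<^sup>2 / 4"
      unfolding y2 by (simp add: field_simps power2_eq_square power4_eq_xxxx)
    hence "(K\<^sup>2 * (y\<^sup>2 - p * D)\<^sup>2) / y ^ 4 = (K ^ 4 * p ^ 4 - K\<^sup>2 * p\<^sup>2 * y\<^sup>2 + K\<^sup>2 * (y\<^sup>2)\<^sup>2 / 4) / y ^ 4"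
      by simp
    also have "\<dots> = rn_wp z ^ 4 - (rn_wp z)\<^sup>2 + K\<^sup>2 / 4"
      using y unfolding rn_wp_z by (simp add: field_simps power2_eq_square power4_eq_xxxx)
    also have "(K\<^sup>2 * (y\<^sup>2 - p * D)\<^sup>2) / y ^ 4 = d\<^sup>2"
      using y unfolding d_def by (simp add: power_mult_distrib power_divide power2_eq_square power4_eq_xxxx mult_ac)
    finally show ?thesis .
  qed
  ultimately show ?thesis using that by (simp add: K_def)
qed

text \<open>
  Removing the singularity at \<open>0\<close> turns the quotient into a holomorphic function \<open>g\<close>. The value of \<open>g'\<close> at \<open>0\<close> selects
  the positive square root in the differential equation.
\<close>

lemma rn_wp_local:
  obtains \<rho> g where "\<rho> > 0" "g holomorphic_on ball 0 \<rho>" "g 0 = 0" "deriv g 0 = of_real k / 2"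
    "\<And>z. z \<in> ball 0 \<rho> - {0} \<Longrightarrow> g z = rn_wp z \<and> z \<notin> \<Lambda> \<and> deriv P z \<noteq> 0"
proof -
  define g where "g = remove_sings rn_wp"
  have "rn_wp meromorphic_on {0}" using rn_wp_meromorphic meromorphic_on_subset by blast
  hence iso: "isolated_singularity_at rn_wp 0" by (rule meromorphic_on_isolated_singularity)
  have "((\<lambda>z. - of_real k * ((z\<^sup>2 * P z - z\<^sup>2 / 6) / (z ^ 3 * deriv P z))) \<longlongrightarrow>
      - of_real k * ((1 - 0\<^sup>2 / 6) / (- 2))) (at 0)"
    by (intro tendsto_intros P_asymptotics) auto
  moreover have "eventually (\<lambda>z. - of_real k * ((z\<^sup>2 * P z - z\<^sup>2 / 6) / (z ^ 3 * deriv P z)) = rn_wp z / z) (at 0)"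
    using eventually_deriv_P_nonzero[of 0] eventually_neq_at_within[of 0]
    by eventually_elim (simp add: rn_wp_def field_simps power_numeral_reduce)
  ultimately have quot: "((\<lambda>z. rn_wp z / z) \<longlongrightarrow> of_real k / 2) (at 0)"
    using Lim_transform_eventually by fastforce
  hence "((\<lambda>z. rn_wp z / z * z) \<longlongrightarrow> of_real k / 2 * 0) (at 0)"
    by (rule tendsto_mult[OF _ tendsto_ident_at])
  moreover have "eventually (\<lambda>z. rn_wp z / z * z = rn_wp z) (at 0)"
    using eventually_neq_at_within[of 0] by eventually_elim simp
  ultimately have lim: "rn_wp \<midarrow>0\<rightarrow> 0"
    using Lim_transform_eventually by fastforce
  have g0: "g 0 = 0" unfolding g_def using lim by (rule remove_sings_eqI)
  have an: "g analytic_on {0}" unfolding g_def using iso lim by (rule remove_sings_analytic_at)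
  have ev: "eventually (\<lambda>z. g z = rn_wp z \<and> z \<notin> \<Lambda> \<and> deriv P z \<noteq> 0) (at 0)"
    unfolding g_def
    by (intro eventually_conj eventually_remove_sings_eq_at[OF iso] eventually_not_mem eventually_deriv_P_nonzero)
  have "((\<lambda>z. (g z - g 0) / (z - 0)) \<longlongrightarrow> of_real k / 2) (at 0)"
    by (rule Lim_transform_eventually[OF quot]) (use ev in \<open>eventually_elim, simp add: g0\<close>)
  hence "(g has_field_derivative of_real k / 2) (at 0)"
    by (simp add: has_field_derivative_iff)
  hence d0: "deriv g 0 = of_real k / 2" by (rule DERIV_imp_deriv)
  obtain e1 where e1: "e1 > 0" "\<And>z. z \<noteq> 0 \<Longrightarrow> dist z 0 < e1 \<Longrightarrow> g z = rn_wp z \<and> z \<notin> \<Lambda> \<and> deriv P z \<noteq> 0"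
    using ev by (auto simp: eventually_at)
  obtain e2 where e2: "e2 > 0" "g holomorphic_on ball 0 e2"
    using an by (auto simp: analytic_on_def)
  show ?thesis
  proof (rule that[of "min e1 e2" g])
    show "g holomorphic_on ball 0 (min e1 e2)"
      using e2(2) by (rule holomorphic_on_subset) auto
  qed (use e1 e2 g0 d0 in auto)
qed

end

context rn_lattice
begin

text \<open>
  As the lattice is symmetric under conjugation, \<open>\<wp>\<close> and \<open>\<wp>'\<close> are real on the real line. The quotient, restricted to a
  small real interval, is thus a real solution of the differential equation that characterises \<open>rn2_real\<close>.
\<close>

lemma rn2_real_eq_rn_wp:
  assumes "cnj ` \<Lambda> \<subseteq> \<Lambda>"
  obtains \<delta> where "\<delta> > 0"
    "\<And>u. u \<noteq> 0 \<Longrightarrow> \<bar>u\<bar> < \<delta> \<Longrightarrow> of_real (rn2_real k u) = rn_wp (of_real u)"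
proof -
  obtain \<rho> g where \<rho>: "\<rho> > 0" and g: "g holomorphic_on ball 0 \<rho>" and g0: "g 0 = 0"
    and dg0: "deriv g 0 = of_real k / 2"
    and gS: "\<And>z. z \<in> ball 0 \<rho> - {0} \<Longrightarrow> g z = rn_wp z \<and> z \<notin> \<Lambda> \<and> deriv P z \<noteq> 0"
    by (rule rn_wp_local) blast
  define \<sigma> where "\<sigma> u = Re (g (of_real u))" for u
  have g_real: "g (of_real u) = of_real (\<sigma> u)" if "\<bar>u\<bar> < \<rho>" for u
  proof (cases "u = 0")
    case False
    hence *: "g (of_real u) = rn_wp (of_real u)" "of_real u \<notin> \<Lambda>"
      using gS[of "of_real u"] that by auto
    have "rn_wp (of_real u) \<in> \<real>"
      unfolding rn_wp_def using P_real[OF assms _ *(2)] by (auto intro!: Reals_mult Reals_minus Reals_divide Reals_diff)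
    thus ?thesis by (simp add: *(1) \<sigma>_def)
  qed (simp add: g0 \<sigma>_def)
  define d where "d u = Re (deriv g (of_real u))" for u
  have der: "(\<sigma> has_real_derivative d u) (at u)" and d_real: "deriv g (of_real u) = of_real (d u)"
    if u: "\<bar>u\<bar> < \<rho>" for u
  proof -
    have "(g has_field_derivative deriv g (of_real u)) (at (of_real u))"
      using holomorphic_derivI[OF g open_ball] u by simp
    hence v: "((\<lambda>u. g (of_real u)) has_vector_derivative deriv g (of_real u)) (at u)"
      by (rule has_vector_derivative_real_field)
    show "(\<sigma> has_real_derivative d u) (at u)"
      using bounded_linear.has_vector_derivative[OF bounded_linear_Re v]
      by (simp add: has_real_derivative_iff_has_vector_derivative \<sigma>_def[abs_def] d_def)
    have "((\<lambda>u. Im (g (of_real u))) has_real_derivative Im (deriv g (of_real u))) (at u)"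
      using bounded_linear.has_vector_derivative[OF bounded_linear_Im v] by (simp add: has_real_derivative_iff_has_vector_derivative)
    moreover have "((\<lambda>u. Im (g (of_real u))) has_real_derivative 0) (at u)"
      by (rule has_field_derivative_transform_within_open[of "\<lambda>_. 0" _ _ "{-\<rho><..<\<rho>}"])
         (use u g_real in \<open>auto simp: abs_less_iff\<close>)
    ultimately have "Im (deriv g (of_real u)) = 0" by (rule DERIV_unique)
    thus "deriv g (of_real u) = of_real (d u)" by (simp add: d_def complex_eq_iff)
  qed
  have ode: "(d u)\<^sup>2 = \<sigma> u ^ 4 - (\<sigma> u)\<^sup>2 + k\<^sup>2 / 4" if u: "\<bar>u\<bar> < \<rho>" for u
  proof (cases "u = 0")
    case True
    have "d 0 = k / 2" unfolding d_def of_real_0 dg0 by simp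
    hence "(d 0)\<^sup>2 = (k / 2)\<^sup>2" by (rule arg_cong)
    thus ?thesis using True by (simp add: \<sigma>_def g0 power_divide)
  next
    case False
    define z where "z = complex_of_real u"
    have z: "z \<in> ball 0 \<rho> - {0}" using u False by (simp add: z_def)
    note * = gS[OF z]
    obtain D where D: "(rn_wp has_field_derivative D) (at z)" "D\<^sup>2 = rn_wp z ^ 4 - (rn_wp z)\<^sup>2 + (of_real k)\<^sup>2 / 4"
      using * by (blast intro: rn_wp_has_derivative[of z])
    have "(g has_field_derivative D) (at z)"
      by (rule has_field_derivative_transform_within_open[OF D(1) _ z]) (use gS in auto)
    hence "deriv g z = D" by (rule DERIV_imp_deriv)
    hence "complex_of_real ((d u)\<^sup>2) = of_real (\<sigma> u ^ 4 - (\<sigma> u)\<^sup>2 + k\<^sup>2 / 4)"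
      using D(2) * d_real[OF u] g_real[OF u] by (simp add: z_def)
    thus ?thesis by (simp only: of_real_eq_iff)
  qed
  have "isCont d 0"
  proof -
    have "deriv g holomorphic_on ball 0 \<rho>" using g by (intro holomorphic_deriv) auto
    hence "deriv g analytic_on {0}" using \<rho> by (metis analytic_at centre_in_ball open_ball)
    hence "isCont (deriv g) (of_real 0)" using analytic_at_imp_isCont by simp
    hence "isCont (\<lambda>u::real. deriv g (of_real u)) 0"
      by (rule isCont_o2[rotated]) (intro continuous_intros)
    thus ?thesis unfolding d_def isCont_def by (rule tendsto_Re)
  qed
  moreover have d0_pos: "d 0 > 0" unfolding d_def of_real_0 dg0 using k_pos by simp
  ultimately have "eventually (\<lambda>u. d u > 0) (at 0)"
    unfolding isCont_def by (intro order_tendstoD)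
  then obtain e1 where e1: "e1 > 0" "\<And>u. u \<noteq> 0 \<Longrightarrow> \<bar>u\<bar> < e1 \<Longrightarrow> d u > 0"
    by (auto simp: eventually_at)
  have "isCont \<sigma> 0" using der[of 0] \<rho> DERIV_isCont by simp
  hence "eventually (\<lambda>u. dist (\<sigma> u) (\<sigma> 0) < k / 2) (at 0)"
    unfolding isCont_def using k_pos by (intro tendstoD) auto
  then obtain e2 where e2: "e2 > 0" "\<And>u. u \<noteq> 0 \<Longrightarrow> \<bar>u\<bar> < e2 \<Longrightarrow> \<bar>\<sigma> u\<bar> < k / 2"
    by (auto simp: eventually_at \<sigma>_def g0)
  define \<delta> where "\<delta> = min \<rho> (min e1 e2)"
  have \<delta>: "\<delta> > 0" using \<rho> e1 e2 by (simp add: \<delta>_def)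
  have rn2: "rn2_real k u = \<sigma> u" if u: "\<bar>u\<bar> < \<delta>" for u
  proof (rule rn2_real_eqI[OF k_pos k_less_1 \<delta>])
    show "\<sigma> 0 = 0" by (simp add: \<sigma>_def g0)
    fix v assume v: "\<bar>v\<bar> < \<delta>"
    show "\<bar>\<sigma> v\<bar> < k / 2"
      using e2(2)[of v] v k_pos by (cases "v = 0") (auto simp: \<delta>_def \<sigma>_def g0)
    have "d v > 0" using e1(2)[of v] v d0_pos by (cases "v = 0") (auto simp: \<delta>_def)
    hence "d v = sqrt (\<sigma> v ^ 4 - (\<sigma> v)\<^sup>2 + k\<^sup>2 / 4)"
      using ode[of v] v by (intro real_sqrt_unique[symmetric]) (auto simp: \<delta>_def)
    thus "(\<sigma> has_real_derivative sqrt (\<sigma> v ^ 4 - (\<sigma> v)\<^sup>2 + k\<^sup>2 / 4)) (at v)"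
      using der[of v] v by (simp add: \<delta>_def)
  qed (use u in auto)
  show ?thesis
  proof (rule that[OF \<delta>])
    fix u assume u: "u \<noteq> 0" "\<bar>u\<bar> < \<delta>"
    thus "of_real (rn2_real k u) = rn_wp (of_real u)"
      using rn2[OF u(2)] g_real[of u] gS[of "of_real u"] by (simp add: \<delta>_def)
  qed
qed

text \<open>
  Two meromorphic functions that agree at points accumulating at \<open>0\<close> agree off a discrete set.
\<close>

lemma elliptic_extension_eq_rn_wp:
  assumes "cnj ` \<Lambda> \<subseteq> \<Lambda>" and f: "elliptic_extension (rn2_real k) f"
  shows "eventually (\<lambda>w. f w = rn_wp w) (at z)"
proof -
  obtain \<delta> where \<delta>: "\<delta> > 0" "\<And>u. u \<noteq> 0 \<Longrightarrow> \<bar>u\<bar> < \<delta> \<Longrightarrow> of_real (rn2_real k u) = rn_wp (of_real u)"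
    by (rule rn2_real_eq_rn_wp[OF assms(1)]) blast
  have mero: "(\<lambda>w. f w - rn_wp w) meromorphic_on UNIV"
    using f rn_wp_meromorphic
    by (intro meromorphic_intros) (simp_all add: elliptic_extension_def elliptic_def nicely_meromorphic_on_def)
  have "\<not> eventually (\<lambda>w. f w - rn_wp w \<noteq> 0) (cosparse UNIV)"
  proof
    assume "eventually (\<lambda>w. f w - rn_wp w \<noteq> 0) (cosparse UNIV)"
    hence "eventually (\<lambda>w. f w - rn_wp w \<noteq> 0) (at 0)" by (rule eventually_cosparse_imp_eventually_at) simp
    then obtain e where e: "e > 0" "\<And>w. w \<noteq> 0 \<Longrightarrow> norm w < e \<Longrightarrow> f w \<noteq> rn_wp w"
      by (auto simp: eventually_at)
    define u where "u = min \<delta> e / 2"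
    have u: "u \<noteq> 0" "\<bar>u\<bar> < \<delta>" "\<bar>u\<bar> < e" using \<delta>(1) e(1) by (auto simp: u_def)
    have "f (of_real u) = rn_wp (of_real u)"
      using \<delta>(2)[OF u(1,2)] f by (simp add: elliptic_extension_def)
    thus False using e(2)[of "of_real u"] u by simp
  qed
  hence "eventually (\<lambda>w. f w - rn_wp w = 0) (cosparse UNIV)"
    using meromorphic_imp_constant_or_avoid[OF mero, of 0] by auto
  hence "eventually (\<lambda>w. f w - rn_wp w = 0) (at z)" by (rule eventually_cosparse_imp_eventually_at) simp
  thus ?thesis by eventually_elim simp
qed

text \<open>
  On the real axis \<open>\<wp>\<close> comes down from \<open>\<infinity>\<close> at \<open>0\<close>. If its value at \<open>\<Omega>\<close> were below the largest root \<open>1/6\<close>, it would pass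
  through \<open>1/6\<close> at a real point \<open>y\<close> before \<open>\<Omega>\<close>. But \<open>1/6\<close> would then be the value at \<open>\<Omega>'\<close> or at \<open>\<Omega> + \<Omega>'\<close>, and \<open>y\<close> is not
  congruent to either, since the imaginary parts do not match.
\<close>

lemma P_half_periods_rectangular:
  fixes \<Omega> :: real and \<Omega>' :: complex
  assumes L: "\<Lambda> = lattice_of (2 * of_real \<Omega>) (2 * \<Omega>')"
    and \<Omega>: "\<Omega> > 0" and \<Omega>': "Re \<Omega>' = 0" "Im \<Omega>' > 0"
  shows "cnj ` \<Lambda> \<subseteq> \<Lambda>"
    and "2 * of_real \<Omega> \<in> \<Lambda>" "2 * \<Omega>' \<in> \<Lambda>" "2 * (of_real \<Omega> + \<Omega>') \<in> \<Lambda>"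
    and "of_real \<Omega> \<notin> \<Lambda>" "\<Omega>' \<notin> \<Lambda>" "of_real \<Omega> + \<Omega>' \<notin> \<Lambda>"
    and "P (of_real \<Omega>) = 1 / 6" "P \<Omega>' \<noteq> 1 / 6" "P (of_real \<Omega> + \<Omega>') \<noteq> 1 / 6"
proof -
  let ?\<Omega> = "complex_of_real \<Omega>"
  have memI: "of_int m * (2 * ?\<Omega>) + of_int n * (2 * \<Omega>') \<in> \<Lambda>" for m n
    unfolding L lattice_of_def by blast
  have memD: "\<exists>m n :: int. Re z = 2 * real_of_int m * \<Omega> \<and> Im z = 2 * real_of_int n * Im \<Omega>'" if "z \<in> \<Lambda>" for z
    using that \<Omega>' unfolding L lattice_of_def by auto
  have odd_Re: "z \<notin> \<Lambda>" if "\<bar>Re z\<bar> = \<Omega>" for z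
  proof
    assume "z \<in> \<Lambda>"
    then obtain m :: int where "Re z = 2 * real_of_int m * \<Omega>" using memD by blast
    hence "\<bar>2 * real_of_int m\<bar> * \<Omega> = \<bar>Re z\<bar>" using \<Omega> by (simp add: abs_mult)
    hence "\<bar>2 * real_of_int m\<bar> * \<Omega> = 1 * \<Omega>" unfolding that mult_1 .
    hence "\<bar>2 * real_of_int m\<bar> = 1" using \<Omega> by (metis less_irrefl mult_right_cancel)
    hence "\<bar>2 * m\<bar> = 1" by linarith
    thus False by presburger
  qed
  have odd_Im: "z \<notin> \<Lambda>" if "\<bar>Im z\<bar> = Im \<Omega>'" for z
  proof
    assume "z \<in> \<Lambda>"
    then obtain n :: int where "Im z = 2 * real_of_int n * Im \<Omega>'" using memD by blast
    hence "\<bar>2 * real_of_int n\<bar> * Im \<Omega>' = \<bar>Im z\<bar>" using \<Omega>' by (simp add: abs_mult)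
    hence "\<bar>2 * real_of_int n\<bar> * Im \<Omega>' = 1 * Im \<Omega>'" unfolding that mult_1 .
    hence "\<bar>2 * real_of_int n\<bar> = 1" using \<Omega>'(2) by (metis less_irrefl mult_right_cancel)
    hence "\<bar>2 * n\<bar> = 1" by linarith
    thus False by presburger
  qed
  show cnj: "cnj ` \<Lambda> \<subseteq> \<Lambda>"
  proof safe
    fix z assume "z \<in> \<Lambda>"
    then obtain m n where "z = of_int m * (2 * ?\<Omega>) + of_int n * (2 * \<Omega>')"
      unfolding L lattice_of_def by blast
    moreover have "cnj \<Omega>' = - \<Omega>'" using \<Omega>' by (simp add: complex_eq_iff)
    ultimately have "cnj z = of_int m * (2 * ?\<Omega>) + of_int (- n) * (2 * \<Omega>')" by simp
    thus "cnj z \<in> \<Lambda>" using memI by metis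
  qed
  show h: "2 * ?\<Omega> \<in> \<Lambda>" "2 * \<Omega>' \<in> \<Lambda>" "2 * (?\<Omega> + \<Omega>') \<in> \<Lambda>"
    using memI[of 1 0] memI[of 0 1] memI[of 1 1] by (simp_all add: algebra_simps)
  show n: "?\<Omega> \<notin> \<Lambda>" "\<Omega>' \<notin> \<Lambda>" "?\<Omega> + \<Omega>' \<notin> \<Lambda>"
    using odd_Re[of ?\<Omega>] odd_Im[of \<Omega>'] odd_Re[of "?\<Omega> + \<Omega>'"] \<Omega> \<Omega>' by simp_all
  note value_imp = P_eq_half_period_value_imp
  have ne: "P ?\<Omega> \<noteq> P \<Omega>'" "P ?\<Omega> \<noteq> P (?\<Omega> + \<Omega>')" "P \<Omega>' \<noteq> P (?\<Omega> + \<Omega>')"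
  proof -
    show "P ?\<Omega> \<noteq> P \<Omega>'"
      using value_imp[OF h(2) n(2) n(1)] odd_Im[of "?\<Omega> - \<Omega>'"] \<Omega> \<Omega>' by auto
    show "P ?\<Omega> \<noteq> P (?\<Omega> + \<Omega>')"
      using value_imp[OF h(3) n(3) n(1)] odd_Im[of "?\<Omega> - (?\<Omega> + \<Omega>')"] \<Omega> \<Omega>' by auto
    show "P \<Omega>' \<noteq> P (?\<Omega> + \<Omega>')"
      using value_imp[OF h(3) n(3) n(2)] odd_Re[of "\<Omega>' - (?\<Omega> + \<Omega>')"] \<Omega> \<Omega>' by auto
  qed
  have not_mem: "complex_of_real x \<notin> \<Lambda>" if "0 < x" "x \<le> \<Omega>" for x
  proof
    assume "complex_of_real x \<in> \<Lambda>"
    then obtain m :: int where m: "x = 2 * real_of_int m * \<Omega>" using memD[of "of_real x"] by auto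
    have "m > 0"
      using that(1) \<Omega> unfolding m by (simp add: zero_less_mult_iff)
    hence "1 * \<Omega> < (2 * real_of_int m) * \<Omega>"
      using \<Omega> by (intro mult_strict_right_mono) auto
    thus False using that(2) m by simp
  qed
  show "P ?\<Omega> = 1 / 6"
  proof (rule ccontr)
    assume ne6: "P ?\<Omega> \<noteq> 1 / 6"
    \<comment> \<open>the half-period at which the value \<open>1/6\<close> is taken instead\<close>
    define w where "w = (if P \<Omega>' = 1 / 6 then \<Omega>' else ?\<Omega> + \<Omega>')"
    have w: "2 * w \<in> \<Lambda>" "w \<notin> \<Lambda>" "Im w = Im \<Omega>'"
      using h n by (auto simp: w_def)
    have "P \<Omega>' = 1 / 6 \<or> P (?\<Omega> + \<Omega>') = 1 / 6"
      using half_period_value[OF h(1) n(1)] half_period_value[OF h(2) n(2)]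
        half_period_value[OF h(3) n(3)] ne ne6 by metis
    hence Pw: "P w = 1 / 6" by (auto simp: w_def)
    have small: "Re (P ?\<Omega>) < 1 / 6"
      using half_period_value[OF h(1) n(1)] ne6 k_pos k_less_1 by auto
    have "((\<lambda>x::real. of_real x ^ 2 * P (of_real x)) \<longlongrightarrow> 1) (at_right 0)"
      by (rule filterlim_compose[OF P_asymptotics(1)])
         (auto simp: filterlim_at eventually_at_right_less intro!: tendsto_eq_intros
           eventually_at_right_less[THEN eventually_mono])
    hence "((\<lambda>x::real. Re (of_real x ^ 2 * P (of_real x))) \<longlongrightarrow> Re 1) (at_right 0)"
      by (rule tendsto_Re)
    hence "eventually (\<lambda>x::real. Re (of_real x ^ 2 * P (of_real x)) > 1 / 2) (at_right 0)"
      by (rule order_tendstoD) simp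
    moreover have "eventually (\<lambda>x::real. x \<in> {0<..<min 1 \<Omega>}) (at_right 0)"
      using \<Omega> by (intro eventually_at_right_real) auto
    ultimately have "eventually (\<lambda>x::real. Re (of_real x ^ 2 * P (of_real x)) > 1 / 2 \<and>
        x \<in> {0<..<min 1 \<Omega>}) (at_right 0)" by (rule eventually_conj)
    then obtain x where x: "Re (of_real x ^ 2 * P (of_real x)) > 1 / 2" "0 < x" "x < 1" "x < \<Omega>"
      using eventually_happens'[of "at_right (0::real)"] by fastforce
    have "x\<^sup>2 * Re (P (of_real x)) > 1 / 2"
      using x(1) by (simp flip: of_real_power)
    moreover have "x\<^sup>2 \<le> 1" "x\<^sup>2 > 0" using x by (auto simp: power_le_one)
    ultimately have big: "Re (P (of_real x)) > 1 / 6"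
    proof -
      have "\<not> Re (P (of_real x)) \<le> 1 / 6"
      proof
        assume "Re (P (of_real x)) \<le> 1 / 6"
        hence "x\<^sup>2 * Re (P (of_real x)) \<le> x\<^sup>2 * (1 / 6)" using \<open>x\<^sup>2 > 0\<close> by simp
        thus False using \<open>x\<^sup>2 * Re (P (of_real x)) > 1 / 2\<close> \<open>x\<^sup>2 \<le> 1\<close> by linarith
      qed
      thus ?thesis by simp
    qed
    have "isCont (\<lambda>t. Re (P (of_real t))) t" if "x \<le> t \<and> t \<le> \<Omega>" for t :: real
    proof -
      have "isCont P (of_real t)"
        using analytic_at_imp_isCont[OF P_analytic] not_mem[of t] that x by auto
      hence "isCont (\<lambda>t::real. P (of_real t)) t"
        by (rule isCont_o2[rotated]) (intro continuous_intros)
      thus ?thesis unfolding isCont_def by (rule tendsto_Re)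
    qed
    then obtain y where y: "x \<le> y" "y \<le> \<Omega>" "Re (P (of_real y)) = 1 / 6"
      using IVT2[of "\<lambda>t. Re (P (of_real t))" \<Omega> "1 / 6" x] small big x by auto
    have ymem: "complex_of_real y \<notin> \<Lambda>" using not_mem[of y] x y by auto
    have "P (of_real y) = 1 / 6"
      using P_real(1)[OF cnj _ ymem] y(3) by (simp add: complex_is_Real_iff complex_eq_iff)
    hence "of_real y - w \<in> \<Lambda>"
      using value_imp[OF w(1,2) ymem] Pw by simp
    moreover have "of_real y - w \<notin> \<Lambda>" by (rule odd_Im) (use w \<Omega>' in simp)
    ultimately show False by contradiction
  qed
  thus "P \<Omega>' \<noteq> 1 / 6" "P (?\<Omega> + \<Omega>') \<noteq> 1 / 6" using ne by metis+
qed

end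

theorem theorem7:
  fixes \<kappa> \<Omega> :: real and \<Omega>' :: complex and rn\<^sub>2 P :: "complex \<Rightarrow> complex"
  assumes "0 < \<kappa>" and "\<kappa> < 1"
    and "elliptic_extension (rn2_real \<kappa>) rn\<^sub>2"
    and "is_weierstrass_function P (of_real (1/12 * (1 + 3 * \<kappa>\<^sup>2))) (of_real (1/216 * (1 - 9 * \<kappa>\<^sup>2)))"
    and "fundamental_periods P (2 * of_real \<Omega>) (2 * \<Omega>')"
    and "\<Omega> > 0"
    and "- \<i> * \<Omega>' \<in> \<real>" and "Re (- \<i> * \<Omega>') > 0"
  shows "simple_zero rn\<^sub>2 0 \<and> simple_zero rn\<^sub>2 (of_real \<Omega>) \<and>
    simple_pole rn\<^sub>2 (of_real \<Omega> + \<Omega>') \<and> simple_pole rn\<^sub>2 \<Omega>'"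
proof -
  obtain \<Lambda> where \<Lambda>: "is_lattice \<Lambda>" "lattice_g2 \<Lambda> = of_real (1/12 * (1 + 3 * \<kappa>\<^sup>2))"
    "lattice_g3 \<Lambda> = of_real (1/216 * (1 - 9 * \<kappa>\<^sup>2))" "P = weierstrass_p \<Lambda>"
    using assms(4) unfolding is_weierstrass_function_def by blast
  interpret rn_lattice \<Lambda> \<kappa>
    using \<Lambda>(1-3) assms(1,2) by unfold_locales
  have L: "\<Lambda> = lattice_of (2 * of_real \<Omega>) (2 * \<Omega>')"
    using assms(5) periods_P by (simp add: fundamental_periods_def \<Lambda>(4))
  have \<Omega>': "Re \<Omega>' = 0" "Im \<Omega>' > 0"
    using assms(7,8) by (simp_all add: complex_is_Real_iff)
  note H = P_half_periods_rectangular[OF L assms(6) \<Omega>']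
  have eq: "eventually (\<lambda>w. rn\<^sub>2 w = rn_wp w) (at z)" for z
    by (rule elliptic_extension_eq_rn_wp[OF H(1) assms(3)])
  have zero: "simple_zero rn\<^sub>2 z" if "simple_zero rn_wp z" for z
  proof -
    have "eventually (\<lambda>w. rn\<^sub>2 w \<noteq> 0) (at z)"
      using eventually_rn_wp_nonzero[of z] eq[of z] by eventually_elim simp
    moreover have "rn\<^sub>2 \<midarrow>z\<rightarrow> 0 \<longleftrightarrow> rn_wp \<midarrow>z\<rightarrow> 0" by (rule tendsto_cong[OF eq])
    ultimately show ?thesis
      using that zorder_cong[OF eq refl, of z] by (auto simp: simple_zero_def isolated_zero_def)
  qed
  have pole: "simple_pole rn\<^sub>2 z" if "simple_pole rn_wp z" for z
    using that zorder_cong[OF eq refl, of z] is_pole_cong[OF eq refl, of z]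
    by (simp add: simple_pole_def)
  show ?thesis
    using zero pole rn_wp_simple_zero_or_pole zorder_rn_wp_0
      zorder_rn_wp_half_period[OF H(2,5)] zorder_rn_wp_half_period[OF H(3,6)] zorder_rn_wp_half_period[OF H(4,7)]
      H(8-10) by simp
qed

end
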